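(* Let $q=2^n$ with $n\ge 3$, let $h$ be a positive integer with $\gcd(n,h)=1$, let $q\equiv\xi\pmod 3$ with $\xi\in\{1,-1\}$, and let the point classes $\mathcal O_i$ and the plane classes $\mathcal O_d^{\mathfrak s}$ of $\mathrm{PG}(3,q)$ be as defined in the context. Through every point of $\mathcal O_0$ there pass exactly $r_{0,d}$ planes of $\mathcal O_d^{\mathfrak s}$, and through every point of $\mathcal O_3$ there pass exactly $r_{3,d}$ planes of $\mathcal O_d^{\mathfrak s}$, where $$r_{0,d}=\begin{cases}0&\text{if } d=q+1,\\ \frac{q^2+\xi q+1}3&\text{if } d=0,\\ \frac{q(q-\xi)}2&\text{if } d=1,\\ q+1&\text{if } d=2,\\ \frac{q^2+\xi q-2}6&\text{if } d=3,\end{cases}\qquad r_{3,d}=\begin{cases}3&\text{if } d=q+1,\\ \frac{q^2+\xi q-2}3&\text{if } d=0,\\ \frac{q(q-\xi)}2&\text{if } d=1,\\ q-2&\text{if } d=2,\\ \frac{q^2+\xi q+4}6&\text{if } d=3.\end{cases}$$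
   Context: Points of $\mathrm{PG}(3,q)$ have homogeneous coordinates $(X_1,X_2,X_3,X_4)$; $U_i$ is the point with $1$ in position $i$ and $0$ elsewhere. $\mathcal A=\{P_t=(1,t,t^{2^h},t^{2^h+1})\mid t\in\mathbb F_q\}\cup\{U_4\}$. $\mathfrak s$ is the symplectic polarity of $\mathrm{PG}(3,q)$ defined by the alternating form $x_1y_4+x_2y_3+x_3y_2+x_4y_1$. The osculating planes are the $q+1$ planes $P^{\mathfrak s}$, $P\in\mathcal A$. Put $\mathcal O_{q+1}=\mathcal A$; for $i\in\{0,1,2,3\}$, $\mathcal O_i$ is the set of points of $\mathrm{PG}(3,q)\setminus\mathcal A$ lying on exactly $i$ osculating planes. For $i\in\{0,1,2,3,q+1\}$, $\mathcal O_i^{\mathfrak s}=\{P^{\mathfrak s}\mid P\in\mathcal O_i\}$ (so $\mathcal O_{q+1}^{\mathfrak s}$ is the set of osculating planes). *)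

theory Defs
  imports "HOL-Analysis.Analysis" "HOL-Number_Theory.Cong"
begin

text \<open>The field with \<open>q\<close> elements is an arbitrary finite field type \<open>'a\<close> with \<open>q = CARD('a)\<close>.
  Points and planes of \<open>PG(3,q)\<close> are the linear subspaces of \<open>'a ^ 4\<close> of dimension 1 and 3, so that
  the incidence of a point \<open>P\<close> and a plane \<open>\<pi>\<close> is \<open>P \<subseteq> \<pi>\<close>.  In the index type \<open>4\<close> the numeral
  \<open>4\<close> denotes the same element as \<open>0\<close>; the coordinates are still 1, 2, 3, 4.\<close>

definition pg_points :: "(('a::field) ^ 4) set set" where
  "pg_points = {P. vec.subspace P \<and> vec.dim P = 1}"

definition hom_point :: "('a::field) ^ 4 \<Rightarrow> ('a ^ 4) set" where
  "hom_point x = vec.span {x}"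

definition U_point :: "4 \<Rightarrow> (('a::field) ^ 4) set" where
  "U_point i = hom_point (axis i 1)"

definition P_point :: "nat \<Rightarrow> 'a::field \<Rightarrow> ('a ^ 4) set" where
  "P_point h t = hom_point (vector [1, t, t ^ (2 ^ h), t ^ (2 ^ h + 1)])"

definition arc :: "nat \<Rightarrow> (('a::field) ^ 4) set set" where
  "arc h = {P_point h t | t. True} \<union> {U_point 4}"

definition alt_form :: "('a::field) ^ 4 \<Rightarrow> 'a ^ 4 \<Rightarrow> 'a" where
  "alt_form x y = x $ 1 * y $ 4 + x $ 2 * y $ 3 + x $ 3 * y $ 2 + x $ 4 * y $ 1"

definition polar :: "(('a::field) ^ 4) set \<Rightarrow> ('a ^ 4) set" where
  "polar W = {y. \<forall>x\<in>W. alt_form x y = 0}"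

definition osculating_planes :: "nat \<Rightarrow> (('a::field) ^ 4) set set" where
  "osculating_planes h = polar ` arc h"

text \<open>The class \<open>\<O>\<^sub>i\<close>; only the indices 0, 1, 2, 3 and \<open>q + 1\<close> are of interest.\<close>

definition point_class :: "nat \<Rightarrow> nat \<Rightarrow> (('a::{field,finite}) ^ 4) set set" where
  "point_class h i =
     (if i = CARD('a) + 1 then arc h
      else {P \<in> pg_points - arc h. card {\<pi> \<in> osculating_planes h. P \<subseteq> \<pi>} = i})"

definition plane_class :: "nat \<Rightarrow> nat \<Rightarrow> (('a::{field,finite}) ^ 4) set set" where
  "plane_class h d = polar ` point_class h d"

end

theory Submission
  imports Defs "HOL-Computational_Algebra.Polynomial"
begin

text \<open>Identify \<open>F\<^sup>4\<close> with \<open>F\<^sup>2 \<otimes> F\<^sup>2\<close>, so that the alternating form becomes the product of the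
  determinant forms on the factors and \<open>P_t = s \<otimes> s\<^sup>\<sigma>\<close> for \<open>s = (1, t)\<close>, where \<open>\<sigma>\<close> is the
  Frobenius power \<open>x \<mapsto> x ^ 2 ^ h\<close>.  A nonzero vector on two osculating planes belonging to \<open>s\<close>
  and \<open>t\<close> is a combination of \<open>s \<otimes> t\<^sup>\<sigma>\<close> and \<open>t \<otimes> s\<^sup>\<sigma>\<close>; since \<open>x \<mapsto> x ^ (2 ^ h - 1)\<close> permutes
  the nonzero elements of \<open>F\<close>, it is on exactly three osculating planes, unless it is a multiple of one of
  these two vectors, when it is on exactly two.  This counts the points of
  \<open>\<O>\<^sub>2\<close> in the plane \<open>P\<^sup>\<s>\<close>, and the remaining numbers follow from the first two factorial moments
  of the number of osculating planes through a vector of \<open>P\<^sup>\<s>\<close>.  The second moment depends only on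
  the number of chords of the arc through \<open>P\<close>.  The equation \<open>x ^ (2 ^ h + 1) = c\<close> has one root if
  \<open>n\<close> is odd, and 0 or 3 roots if \<open>n\<close> is even.  Hence no chord passes through a point of \<open>\<O>\<^sub>0\<close> or
  \<open>\<O>\<^sub>3\<close> for odd \<open>n\<close>; for even \<open>n\<close> every chord has all its other points in these two classes,
  no point is on two chords, and a count over the whole space shows that every
  such point is on exactly one chord.\<close>

subsection \<open>Finite fields of even order\<close>

lemma card_nonzero: "card (-{0 :: 'a::{zero,finite}}) = CARD('a) - 1"
  by (simp add: Compl_eq_Diff_UNIV)

lemma bij_betw_endo:
  assumes "finite A" "inj_on f A" "\<And>x. x \<in> A \<Longrightarrow> f x \<in> A"
  shows "bij_betw f A A"
  using assms by (simp add: bij_betw_def endo_inj_surj image_subsetI)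

text \<open>Multiplication by \<open>x\<close> permutes the nonzero elements, so it leaves their
  product unchanged; cancel that product.\<close>

lemma finite_field_power_card_minus_1:
  fixes x :: "'a::{field,finite}"
  assumes "x \<noteq> 0"
  shows "x ^ (CARD('a) - 1) = 1"
proof -
  have "bij_betw ((*) x) (-{0}) (-{0})"
    using assms by (intro bij_betwI[where g = "\<lambda>y. y / x"]) auto
  then have "(\<Prod>y\<in>-{0}. x * y) = \<Prod>(-{0})"
    by (rule prod.reindex_bij_betw)
  then have "x ^ card (-{0::'a}) * \<Prod>(-{0}) = \<Prod>(-{0})"
    by (simp add: prod.distrib)
  moreover have "\<Prod>(-{0::'a}) \<noteq> 0"
    by simp
  ultimately show ?thesis
    by (simp add: card_nonzero)
qed

text \<open>Translation by 1 permutes the field and so preserves the sum of all elements.\<close>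

lemma finite_field_of_nat_card: "of_nat CARD('a) = (0 :: 'a::{field,finite})"
proof -
  have "bij_betw (\<lambda>x. x + 1) (UNIV :: 'a set) UNIV"
    by (intro bij_betwI[where g = "\<lambda>y. y - 1"]) auto
  then have "(\<Sum>x\<in>UNIV. x + 1) = (\<Sum>x\<in>UNIV. x :: 'a)"
    by (rule sum.reindex_bij_betw)
  then show ?thesis
    by (simp add: sum.distrib)
qed

locale even_field =
  fixes n h :: nat and F :: "'a::{field,finite} itself"
  assumes card_field: "CARD('a) = 2 ^ n"
    and coprime_n_h: "gcd n h = 1"
begin

lemma two_le_card: "2 \<le> CARD('a)"
  using card_mono[of "UNIV :: 'a set" "{0, 1}"] by simp

lemma two_eq_0: "(2 :: 'a) = 0"
proof -
  have "(2 :: 'a) ^ n = 0"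
    using finite_field_of_nat_card[where ?'a = 'a] card_field by simp
  then show ?thesis by simp
qed

lemma add_self: "x + x = (0 :: 'a)"
  using two_eq_0 by (metis mult_2 mult_zero_left)

lemma minus_eq: "- x = (x :: 'a)"
  using add_self[of x] by (simp add: eq_neg_iff_add_eq_0[symmetric])

lemma diff_eq: "x - y = (x + y :: 'a)"
  using minus_eq[of y] by (metis diff_conv_add_uminus)

lemma add_eq_0: "x + y = (0 :: 'a) \<longleftrightarrow> x = y"
  by (metis diff_eq right_minus_eq)

lemma power2_pow_add: "(x + y :: 'a) ^ (2 ^ k) = x ^ (2 ^ k) + y ^ (2 ^ k)"
proof (induction k)
  case (Suc k)
  have "(x + y) ^ (2 ^ Suc k) = ((x + y) ^ (2 ^ k))\<^sup>2"
    by (simp add: power_mult[symmetric] mult.commute)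
  also have "\<dots> = (x ^ (2 ^ k))\<^sup>2 + (y ^ (2 ^ k))\<^sup>2"
    unfolding Suc power2_sum by (simp add: two_eq_0)
  finally show ?case
    by (simp add: power_mult[symmetric] mult.commute)
qed simp

lemma power_2_pow_fixed_iterate:
  fixes x :: 'a
  assumes "x ^ (2 ^ k) = x"
  shows "x ^ (2 ^ (k * j)) = x"
proof (induction j)
  case (Suc j)
  have "x ^ (2 ^ (k * Suc j)) = (x ^ (2 ^ k)) ^ (2 ^ (k * j))"
    by (simp add: power_mult[symmetric] power_add)
  then show ?case using assms Suc by simp
qed simp

lemma power_card_eq: "x ^ (2 ^ n) = (x :: 'a)"
proof (cases "x = 0")
  case False
  have "x ^ (2 ^ n) = x ^ (CARD('a) - 1) * x"
    using card_field two_le_card by (metis One_nat_def Suc_pred less_le_trans pos2 power_Suc2)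
  then show ?thesis
    using finite_field_power_card_minus_1[OF False] by simp
qed simp

text \<open>\<open>x\<close> is fixed by the \<open>k\<close>-th and the \<open>n\<close>-th iterate
  of squaring, hence by squaring itself, since the exponents are coprime.\<close>

lemma power_fixed_cases:
  fixes x :: 'a
  assumes "x ^ (2 ^ k) = x" "gcd n k = 1"
  shows "x = 0 \<or> x = 1"
proof -
  have "x\<^sup>2 = x"
  proof (cases "k = 0")
    case True
    then have "n = 1" using assms by simp
    then show ?thesis using power_card_eq[of x] by simp
  next
    case False
    \<comment> \<open>Bezout over the naturals, with one multiple larger than the other by the gcd;
      this form needs \<open>k\<close> nonzero.\<close>
    then obtain a b where ab: "k * a = n * b + gcd k n"
      using bezout_nat by blast
    have "x = x ^ (2 ^ (k * a))"
      using power_2_pow_fixed_iterate[OF assms(1)] by simp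
    also have "\<dots> = (x ^ (2 ^ (n * b)))\<^sup>2"
      unfolding ab using assms(2) by (simp add: power_mult[symmetric] gcd.commute mult.commute)
    also have "\<dots> = x\<^sup>2"
      using power_2_pow_fixed_iterate[OF power_card_eq] by simp
    finally show ?thesis by simp
  qed
  then show ?thesis by (simp add: power2_eq_square)
qed

section \<open>The automorphism \<open>frob\<close> and the maps \<open>frob x / x\<close> and
  \<open>frob x * x\<close>\<close>

definition frob :: "'a \<Rightarrow> 'a" where "frob x = x ^ (2 ^ h)"

lemma frob_simps [simp]:
  "frob 0 = 0" "frob 1 = 1" "frob (x + y) = frob x + frob y" "frob (x * y) = frob x * frob y"
  "frob (x / y) = frob x / frob y" "frob x = 0 \<longleftrightarrow> x = 0"
  by (simp_all add: frob_def power2_pow_add power_mult_distrib power_divide)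

lemma inj_frob: "inj frob"
proof (rule injI)
  fix x y assume "frob x = frob y"
  then have "frob (x + y) = 0" by (simp add: add_self)
  then show "x = y" by (simp add: add_eq_0 del: frob_simps(3))
qed

lemma bij_frob: "bij frob"
  using inj_frob finite_UNIV_inj_surj[of frob] by (simp add: bij_def)

lemma frob_ratio_inj:
  assumes "x \<noteq> 0" "y \<noteq> 0" "frob x * y = x * frob y"
  shows "x = y"
proof -
  have "frob (x / y) = x / y"
    using assms by (simp add: field_simps)
  then have "x / y = 0 \<or> x / y = 1"
    using power_fixed_cases[of "x / y" h] coprime_n_h by (simp add: frob_def)
  then show ?thesis using assms by auto
qed

text \<open>This is the power map with exponent \<open>2 ^ h - 1\<close>; an injective self-map of a
  finite set is bijective.\<close>

lemma frob_ratio_bij: "bij_betw (\<lambda>x. frob x / x) (-{0}) (-{0})"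
proof -
  have inj: "inj_on (\<lambda>x. frob x / x) (-{0})"
  proof (rule inj_onI)
    fix x y :: 'a assume "x \<in> -{0}" "y \<in> -{0}" "frob x / x = frob y / y"
    then have xy: "x \<noteq> 0" "y \<noteq> 0" "frob x * y = frob y * x" by (simp_all add: frac_eq_eq)
    show "x = y" using frob_ratio_inj[OF xy(1,2)] xy(3) by (simp only: mult.commute)
  qed
  then show ?thesis
    by (rule bij_betw_endo[rotated]) simp_all
qed

text \<open>A quotient \<open>z\<close> of two elements with the same image satisfies
  \<open>frob z = 1 / z\<close>, so it is fixed by the square of \<open>frob\<close>. For odd
  \<open>n\<close> the exponent \<open>2 * h\<close> is still coprime to \<open>n\<close>, which
  forces \<open>z = 1\<close>.\<close>

lemma frob_norm_bij:
  assumes "odd n"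
  shows "bij_betw (\<lambda>x. frob x * x) (-{0}) (-{0})"
proof -
  have "inj_on (\<lambda>x. frob x * x) (-{0})"
  proof (rule inj_onI)
    fix x y :: 'a assume xy: "x \<in> -{0}" "y \<in> -{0}" "frob x * x = frob y * y"
    define z where "z = x / y"
    have "frob z * z = (frob x * x) / (frob y * y)" by (simp add: z_def)
    then have z: "z \<noteq> 0" "frob z * z = 1" using xy by (simp_all add: z_def)
    then have "frob z = 1 / z" by (simp add: field_simps)
    then have "frob (frob z) = z" by simp
    then have "z ^ (2 ^ (2 * h)) = z"
      by (simp add: frob_def power_mult[symmetric] power_add[symmetric] mult_2)
    moreover have "gcd n (2 * h) = 1"
      using assms coprime_n_h by (metis coprime_iff_gcd_eq_1 coprime_mult_right_iff coprime_right_2_iff_odd)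
    ultimately have "z = 1" using power_fixed_cases[of z "2 * h"] z(1) by simp
    then show "x = y" using xy by (simp add: z_def)
  qed
  then show ?thesis
    by (rule bij_betw_endo[rotated]) simp_all
qed

text \<open>For even \<open>n\<close>, 3 divides the order of the multiplicative group. With
  \<open>k\<close> a third of that order, \<open>x ^ k\<close> is always a cube root of 1, and the
  polynomial \<open>monom 1 k - 1\<close> has too few roots for it to be 1 at every nonzero
  \<open>x\<close>.\<close>

lemma cube_root_of_unity:
  assumes "even n"
  obtains w :: 'a where "w \<noteq> 1" "w ^ 3 = 1"
proof -
  obtain m where m: "n = 2 * m" using assms by blast
  have "(4::nat) ^ m mod 3 = 1" by (induction m) (auto simp: mod_mult_right_eq[symmetric])
  then have "(2::nat) ^ n mod 3 = 1" by (simp add: m power_mult)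
  then have dvd: "3 dvd CARD('a) - 1"
    using card_field two_le_card by (metis dvd_minus_mod)
  define k where "k = (CARD('a) - 1) div 3"
  have k: "k * 3 = CARD('a) - 1" "0 < k"
    using dvd two_le_card by (auto simp: k_def)
  define p :: "'a poly" where "p = monom 1 k - 1"
  have deg: "degree p = k"
  proof -
    have "degree (monom 1 k + (- 1) :: 'a poly) = degree (monom (1::'a) k)"
      using k by (intro degree_add_eq_left) (simp add: degree_monom_eq)
    then show ?thesis by (simp add: p_def degree_monom_eq)
  qed
  then have "p \<noteq> 0" using k by auto
  then have "card {x. poly p x = 0} < card (-{0::'a})"
    using card_poly_roots_bound[of p] deg k by (simp add: card_nonzero)
  then have "\<not> -{0} \<subseteq> {x. poly p x = 0}"
    by (metis card_mono finite leD)
  then obtain x :: 'a where x: "x \<noteq> 0" "x ^ k \<noteq> 1"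
    by (auto simp: p_def poly_monom)
  moreover have "(x ^ k) ^ 3 = 1"
    using finite_field_power_card_minus_1[OF x(1)] k by (simp add: power_mult[symmetric])
  ultimately show ?thesis using that by blast
qed

end

subsection \<open>The twisted tensor model of the arc\<close>

lemma vector_4_nth [simp]:
  "(vector [a, b, c, d] :: 'a::zero ^ 4) $ 1 = a"
  "(vector [a, b, c, d] :: 'a::zero ^ 4) $ 2 = b"
  "(vector [a, b, c, d] :: 'a::zero ^ 4) $ 3 = c"
  "(vector [a, b, c, d] :: 'a::zero ^ 4) $ 4 = d"
  by (simp_all add: vector_def)

lemma alt_form_commute: "alt_form x y = alt_form y x"
  by (simp add: alt_form_def algebra_simps)

lemma alt_form_linear [simp]:
  "alt_form (x + y) z = alt_form x z + alt_form y z"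
  "alt_form z (x + y) = alt_form z x + alt_form z y"
  "alt_form (c *s x) z = c * alt_form x z"
  "alt_form z (c *s x) = c * alt_form z x"
  "alt_form z (x - y) = alt_form z x - alt_form z y"
  "alt_form 0 z = 0" "alt_form z 0 = 0"
  by (simp_all add: alt_form_def algebra_simps)

lemma alt_form_nondegenerate:
  assumes "\<And>y. alt_form x y = 0"
  shows "x = 0"
proof -
  have "x $ i = 0" for i
    using assms[of "axis 1 1"] assms[of "axis 2 1"] assms[of "axis 3 1"] assms[of "axis 4 1"]
      exhaust_4[of i] by (auto simp: alt_form_def axis_def)
  then show ?thesis by (simp add: vec_eq_iff)
qed

text \<open>The order of the coordinates makes \<open>ten (1, t) (1, t ^ 2 ^ h)\<close> the vector in \<open>P_point h t\<close>.
  The determinant \<open>br\<close> has a plus sign because the characteristic is 2, and \<open>reps\<close> is one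
  representative for each point of the projective line.\<close>

definition ten :: "'a::field \<times> 'a \<Rightarrow> 'a \<times> 'a \<Rightarrow> 'a ^ 4" where
  "ten u w = vector [fst u * fst w, snd u * fst w, fst u * snd w, snd u * snd w]"

definition br :: "'a::field \<times> 'a \<Rightarrow> 'a \<times> 'a \<Rightarrow> 'a" where
  "br u v = fst u * snd v + snd u * fst v"

definition reps :: "('a::field \<times> 'a) set" where
  "reps = insert (0, 1) (range (Pair 1))"

lemma alt_form_ten [simp]: "alt_form (ten a b) (ten c d) = br a c * br b d"
  by (simp add: alt_form_def ten_def br_def algebra_simps)

lemma br_commute: "br u v = br v u"
  by (simp add: br_def algebra_simps)

lemma card_reps: "card (reps :: ('a::{field,finite} \<times> 'a) set) = CARD('a) + 1"
proof -
  have "card (range (Pair (1::'a)) :: ('a \<times> 'a) set) = CARD('a)"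
    by (intro card_image injI) simp
  then show ?thesis by (subst reps_def) (subst card_insert_disjoint, auto)
qed

context even_field
begin

lemma four_eq_0: "(4 :: 'a) = 0"
  using two_eq_0 by (metis mult_zero_left mult_2 numeral_Bit0)

lemma add_self_left: "x + (x + y) = (y :: 'a)"
  by (metis add.assoc add_0 add_self)

text \<open>The four tensors form two mutually orthogonal hyperbolic pairs, both with form value
  \<open>br s t * br a b\<close>. Leaving this factor on the left makes the expansion a polynomial
  identity.\<close>

lemma ten_decomposition:
  "(br s t * br a b) *s y =
    alt_form y (ten t b) *s ten s a + alt_form y (ten t a) *s ten s b
    + (alt_form y (ten s b) *s ten t a + alt_form y (ten s a) *s ten t (b :: 'a \<times> 'a))"
  unfolding vec_eq_iff forall_4
  by (simp add: alt_form_def ten_def br_def algebra_simps two_eq_0 four_eq_0)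

lemma br_self [simp]: "br u u = (0 :: 'a)"
  by (simp add: br_def mult.commute add_self)

lemma br_eq_0_iff: "u \<in> reps \<Longrightarrow> v \<in> reps \<Longrightarrow> br u v = (0 :: 'a) \<longleftrightarrow> u = v"
  by (auto simp: reps_def br_def add_eq_0)

text \<open>The Pluecker relation for 2 by 2 determinants, without signs in characteristic
  2.\<close>

lemma br_plucker: "br s u * br t w + br t u * br s w = br s t * br u (w :: 'a \<times> 'a)"
  by (simp add: br_def algebra_simps add_self add_self_left)

definition fr :: "'a \<times> 'a \<Rightarrow> 'a \<times> 'a" where
  "fr u = (frob (fst u), frob (snd u))"

lemma br_fr [simp]: "br (fr u) (fr v) = frob (br u v)"
  by (simp add: br_def fr_def)

definition curve :: "'a \<times> 'a \<Rightarrow> 'a ^ 4" where "curve s = ten s (fr s)"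

text \<open>Parameters of the osculating planes containing \<open>y\<close>; since the form is
  symmetric, also of the arc points in the plane polar to \<open>y\<close>.\<close>

definition zeros :: "'a ^ 4 \<Rightarrow> ('a \<times> 'a) set" where
  "zeros y = {s \<in> reps. alt_form (curve s) y = 0}"


section \<open>Vectors on two or more osculating planes\<close>

lemma frob_eq_iff [simp]: "frob x = frob y \<longleftrightarrow> x = y"
  using inj_frob by (auto dest: injD)

lemma zeros_subset: "zeros y \<subseteq> reps"
  by (auto simp: zeros_def)

lemma alt_form_curve_ten: "alt_form (curve u) (ten s (fr t)) = br s u * frob (br t u)"
  by (simp add: curve_def br_commute)

lemma alt_form_curve_curve: "alt_form (curve s) (curve t) = br s t * frob (br s t)"
  by (simp add: curve_def)

text \<open>The case \<open>a = fr s\<close>, \<open>b = fr t\<close> of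
  \<open>ten_decomposition\<close>, divided by the determinant factor. The value of \<open>k\<close>
  never matters, only which of the four coefficients vanish.\<close>

lemma fr_decomposition:
  assumes "s \<in> reps" "t \<in> reps" "s \<noteq> t"
  shows "\<exists>k. k \<noteq> 0 \<and> y =
    (k * alt_form y (curve t)) *s curve s + (k * alt_form y (ten t (fr s))) *s ten s (fr t)
    + ((k * alt_form y (ten s (fr t))) *s ten t (fr s) + (k * alt_form y (curve s)) *s curve t)"
proof -
  define d where "d = br s t * frob (br s t)"
  have d: "d \<noteq> 0" using assms by (simp add: d_def br_eq_0_iff)
  have "y = inverse d *s (d *s y)" using d by (simp add: vector_smult_assoc)
  also have "d *s y = alt_form y (curve t) *s curve s + alt_form y (ten t (fr s)) *s ten s (fr t)
    + (alt_form y (ten s (fr t)) *s ten t (fr s) + alt_form y (curve s) *s curve t)"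
    using ten_decomposition[of s t "fr s" "fr t" y] by (simp add: d_def curve_def)
  finally have "y = inverse d *s \<dots>" .
  then show ?thesis
    using d by (intro exI[of _ "inverse d"]) (simp add: vec.scale_right_distrib vector_smult_assoc)
qed

text \<open>The quotient is a coordinate on the projective line with its zero at \<open>s\<close>
  and its pole at \<open>t\<close>. It is injective by the Pluecker relation, and both sides have
  \<open>q - 1\<close> elements.\<close>

lemma ratio_bij:
  assumes "s \<in> reps" "t \<in> reps" "s \<noteq> t"
  shows "bij_betw (\<lambda>u. br s u / br t u) (reps - {s, t}) (-{0 :: 'a})"
proof -
  let ?r = "\<lambda>u. br s u / br t u"
  have inj: "inj_on ?r (reps - {s, t})"
  proof (rule inj_onI)
    fix u w assume uw: "u \<in> reps - {s, t}" "w \<in> reps - {s, t}" "?r u = ?r w"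
    then have "br t u \<noteq> 0" "br t w \<noteq> 0"
      using assms by (auto simp: br_eq_0_iff)
    then have "br s u * br t w = br s w * br t u"
      using uw(3) by (simp add: frac_eq_eq)
    then have "br s t * br u w = 0"
      using br_plucker[of s u t w] by (simp add: mult.commute add_self)
    then show "u = w" using assms uw by (simp add: br_eq_0_iff)
  qed
  moreover have "?r ` (reps - {s, t}) \<subseteq> -{0}"
    using assms by (auto simp: br_eq_0_iff)
  moreover have "card (reps - {s, t}) = card (-{0 :: 'a})"
    using assms by (simp add: card_Diff_subset card_reps card_nonzero)
  ultimately show ?thesis
    by (simp add: bij_betw_def card_image card_subset_eq)
qed

lemma zeros_pair:
  assumes "s \<in> reps" "t \<in> reps" "s \<noteq> t"
  shows "zeros (a *s ten s (fr t) + b *s ten t (fr s)) =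
    {s, t} \<union> {u \<in> reps - {s, t}. a = b * (frob (br s u / br t u) / (br s u / br t u))}"
proof (rule set_eqI)
  fix u
  show "u \<in> zeros (a *s ten s (fr t) + b *s ten t (fr s)) \<longleftrightarrow>
    u \<in> {s, t} \<union> {u \<in> reps - {s, t}. a = b * (frob (br s u / br t u) / (br s u / br t u))}"
  proof (cases "u \<in> {s, t} \<or> u \<notin> reps")
    case True
    then show ?thesis using assms by (auto simp: zeros_def alt_form_curve_ten)
  next
    case False
    then have "br s u \<noteq> 0" "br t u \<noteq> 0" using assms by (auto simp: br_eq_0_iff)
    then have "a * (br s u * frob (br t u)) = b * (br t u * frob (br s u)) \<longleftrightarrow>
      a = b * (frob (br s u / br t u) / (br s u / br t u))"
      by (simp add: field_simps)
    then show ?thesis using False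
      by (simp add: zeros_def alt_form_curve_ten add_eq_0)
  qed
qed

text \<open>In the coordinate of \<open>ratio_bij\<close> the zeros other than \<open>s\<close> and
  \<open>t\<close> solve \<open>frob x / x = a / b\<close>, which has a unique solution by
  \<open>frob_ratio_bij\<close>.\<close>

lemma card_zeros_pair:
  assumes st: "s \<in> reps" "t \<in> reps" "s \<noteq> t" and "a \<noteq> 0" "b \<noteq> 0"
  shows "card (zeros (a *s ten s (fr t) + b *s ten t (fr s))) = 3"
proof -
  have "bij_betw ((\<lambda>x. frob x / x) \<circ> (\<lambda>u. br s u / br t u)) (reps - {s, t}) (-{0 :: 'a})"
    by (rule bij_betw_trans[OF ratio_bij[OF st] frob_ratio_bij])
  moreover have "a / b \<in> -{0}" using assms by simp
  ultimately have "\<exists>!u. u \<in> reps - {s, t} \<and> ((\<lambda>x. frob x / x) \<circ> (\<lambda>u. br s u / br t u)) u = a / b"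
    unfolding bij_betw_def inj_on_def by (smt (verit, ccfv_threshold) imageE)
  then obtain u where u: "u \<in> reps - {s, t}"
    "{u \<in> reps - {s, t}. frob (br s u / br t u) / (br s u / br t u) = a / b} = {u}"
    unfolding comp_def by blast
  have "a = b * x \<longleftrightarrow> x = a / b" for x using assms by (auto simp: field_simps)
  then have "zeros (a *s ten s (fr t) + b *s ten t (fr s)) = {s, t} \<union> {u}"
    unfolding zeros_pair[OF st] by (simp only: u(2))
  then show ?thesis using u(1) st by auto
qed

lemma zeros_ten:
  assumes "s \<in> reps" "t \<in> reps" "k \<noteq> 0"
  shows "zeros (k *s ten s (fr t)) = {s, t}"
  using assms by (auto simp: zeros_def alt_form_curve_ten br_eq_0_iff)

text \<open>Orthogonality to \<open>curve s\<close> and \<open>curve t\<close> kills two of the four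
  coefficients in \<open>fr_decomposition\<close>.\<close>

lemma two_zeros:
  assumes "s \<in> zeros y" "t \<in> zeros y" "s \<noteq> t"
  obtains a b where "y = a *s ten s (fr t) + b *s ten t (fr s)"
proof -
  have "s \<in> reps" "t \<in> reps" "alt_form y (curve s) = 0" "alt_form y (curve t) = 0"
    using assms by (auto simp: zeros_def alt_form_commute)
  then show ?thesis
    using fr_decomposition[of s t y] assms(3) that by auto
qed

lemma two_zeros_cases:
  assumes "s \<in> zeros y" "t \<in> zeros y" "s \<noteq> t" "y \<noteq> 0"
  obtains "card (zeros y) = 3" | k where "k \<noteq> 0" "y = k *s ten s (fr t)"
    | k where "k \<noteq> 0" "y = k *s ten t (fr s)"
proof -
  obtain a b where y: "y = a *s ten s (fr t) + b *s ten t (fr s)"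
    using two_zeros assms by blast
  have st: "s \<in> reps" "t \<in> reps" using assms zeros_subset by blast+
  consider "a \<noteq> 0" "b \<noteq> 0" | "a = 0" "b \<noteq> 0" | "a \<noteq> 0" "b = 0" | "a = 0" "b = 0" by blast
  then show ?thesis
  proof cases
    case 1
    then show ?thesis using card_zeros_pair[OF st assms(3)] y that(1) by simp
  qed (use y that assms in auto)
qed

lemma card_zeros_cases:
  assumes "y \<noteq> 0"
  shows "card (zeros y) \<in> {0, 1, 2, 3}"
proof (rule ccontr)
  assume *: "card (zeros y) \<notin> {0, 1, 2, 3}"
  then have "\<not> card (zeros y) \<le> Suc 0" by (simp add: le_Suc_eq)
  then obtain s t where st: "s \<in> zeros y" "t \<in> zeros y" "s \<noteq> t"
    by (metis card_le_Suc0_iff_eq finite)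
  then have "s \<in> reps" "t \<in> reps" using zeros_subset by blast+
  with st assms * show False
    by (cases rule: two_zeros_cases[OF st assms]) (auto simp: zeros_ten)
qed

text \<open>The two exceptional cases of \<open>two_zeros_cases\<close> differ by exchanging
  \<open>s\<close> and \<open>t\<close>, so ordered pairs cover both with a single tensor.\<close>

lemma card_zeros_eq_2:
  assumes "y \<noteq> 0"
  shows "card (zeros y) = 2 \<longleftrightarrow>
    (\<exists>s\<in>reps. \<exists>t\<in>reps. s \<noteq> t \<and> (\<exists>k. k \<noteq> 0 \<and> y = k *s ten s (fr t)))"
proof
  assume *: "card (zeros y) = 2"
  then obtain s t where st: "s \<in> zeros y" "t \<in> zeros y" "s \<noteq> t"
    unfolding card_2_iff by blast
  then have "s \<in> reps" "t \<in> reps" using zeros_subset by blast+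
  with st * show "\<exists>s\<in>reps. \<exists>t\<in>reps. s \<noteq> t \<and> (\<exists>k. k \<noteq> 0 \<and> y = k *s ten s (fr t))"
    by (cases rule: two_zeros_cases[OF st assms]) (simp, metis+)
qed (elim bexE exE conjE, simp add: zeros_ten)

lemma zeros_0: "zeros 0 = reps"
  by (simp add: zeros_def)

lemma zeros_curve: "s \<in> reps \<Longrightarrow> k \<noteq> 0 \<Longrightarrow> zeros (k *s curve s) = {s}"
  by (auto simp: zeros_def alt_form_curve_curve br_eq_0_iff)


section \<open>Chords of the arc\<close>

text \<open>By \<open>chord_iff\<close> below, \<open>chord p s t\<close> says that \<open>p\<close> lies on the line joining the arc points of
  \<open>s\<close> and \<open>t\<close>; this dual form is what the intersection numbers of planes need.\<close>

definition chord :: "'a ^ 4 \<Rightarrow> 'a \<times> 'a \<Rightarrow> 'a \<times> 'a \<Rightarrow> bool" where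
  "chord p s t \<longleftrightarrow> alt_form p (ten s (fr t)) = 0 \<and> alt_form p (ten t (fr s)) = 0"

lemma chord_iff:
  assumes "s \<in> reps" "t \<in> reps" "s \<noteq> t"
  shows "chord p s t \<longleftrightarrow> (\<exists>a b. p = a *s curve s + b *s curve t)"
proof
  assume "chord p s t"
  then show "\<exists>a b. p = a *s curve s + b *s curve t"
    using fr_decomposition[OF assms, of p] by (auto simp: chord_def)
qed (auto simp: chord_def alt_form_curve_ten)

text \<open>The parameters \<open>s\<close> and \<open>t\<close> drop out, because
  \<open>curve s\<close> and \<open>curve t\<close> are isotropic but not orthogonal to each other;
  the others are governed by the norm-like map \<open>frob x * x\<close>.\<close>

lemma zeros_chord:
  assumes st: "s \<in> reps" "t \<in> reps" "s \<noteq> t" and ab: "a \<noteq> 0" "b \<noteq> 0"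
  shows "zeros (a *s curve s + b *s curve t) =
    {u \<in> reps - {s, t}. frob (br s u / br t u) * (br s u / br t u) = b / a}"
proof (rule set_eqI)
  fix u
  show "u \<in> zeros (a *s curve s + b *s curve t) \<longleftrightarrow>
    u \<in> {u \<in> reps - {s, t}. frob (br s u / br t u) * (br s u / br t u) = b / a}"
  proof (cases "u \<in> {s, t} \<or> u \<notin> reps")
    case True
    then show ?thesis using assms by (auto simp: zeros_def alt_form_curve_curve br_eq_0_iff)
  next
    case False
    then have "br t u \<noteq> 0" using assms by (auto simp: br_eq_0_iff)
    then have "a * (br s u * frob (br s u)) = b * (br t u * frob (br t u)) \<longleftrightarrow>
      frob (br s u / br t u) * (br s u / br t u) = b / a"
      using ab by (simp add: field_simps)
    moreover have "alt_form (curve u) (a *s curve s + b *s curve t) = 0 \<longleftrightarrow>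
      a * (br s u * frob (br s u)) = b * (br t u * frob (br t u))"
      by (simp only: alt_form_linear alt_form_curve_curve add_eq_0 br_commute[of u])
    ultimately show ?thesis using False unfolding zeros_def by blast
  qed
qed

lemma card_zeros_chord_eq:
  assumes st: "s \<in> reps" "t \<in> reps" "s \<noteq> t" and ab: "a \<noteq> 0" "b \<noteq> 0"
  shows "card (zeros (a *s curve s + b *s curve t)) = card {x. x \<noteq> 0 \<and> frob x * x = b / a}"
proof -
  have "bij_betw (\<lambda>u. br s u / br t u)
      {u \<in> reps - {s, t}. frob (br s u / br t u) * (br s u / br t u) = b / a}
      {x \<in> -{0}. frob x * x = b / a}"
    by (rule bij_betw_Collect[OF ratio_bij[OF st]]) simp
  then show ?thesis
    unfolding zeros_chord[OF assms] by (simp only: bij_betw_same_card Compl_iff singleton_iff)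
qed

lemma chord_point_nonzero:
  assumes "s \<in> reps" "t \<in> reps" "s \<noteq> t" "a \<noteq> 0" "b \<noteq> 0"
  shows "a *s curve s + b *s curve t \<noteq> 0"
proof
  assume "a *s curve s + b *s curve t = 0"
  then have "alt_form (a *s curve s + b *s curve t) (curve t) = 0" by simp
  then show False using assms by (simp add: alt_form_curve_curve br_eq_0_iff)
qed

text \<open>For odd \<open>n\<close> the map \<open>frob x * x\<close> is bijective. For even
  \<open>n\<close> the solutions are permuted by a nontrivial cube root of unity, so there are none
  or at least three, and \<open>card_zeros_cases\<close> allows at most three.\<close>

lemma card_zeros_chord:
  assumes st: "s \<in> reps" "t \<in> reps" "s \<noteq> t" and ab: "a \<noteq> 0" "b \<noteq> 0"
  shows "card (zeros (a *s curve s + b *s curve t)) \<in> (if even n then {0, 3} else {1})"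
proof (cases "even n")
  case False
  have "b / a \<in> -{0}" using ab by simp
  then have "b / a \<in> (\<lambda>x. frob x * x) ` (-{0})"
    using frob_norm_bij[OF False] by (simp only: bij_betw_def)
  then obtain x where x: "x \<in> -{0}" "b / a = frob x * x" by blast
  have "y = x" if "y \<noteq> 0" "frob y * y = frob x * x" for y
    using inj_onD[OF bij_betw_imp_inj_on[OF frob_norm_bij[OF False]], of y x] that x(1) by simp
  then have "{y. y \<noteq> 0 \<and> frob y * y = b / a} = {x}"
    using x unfolding x(2) by blast
  then show ?thesis using card_zeros_chord_eq[OF assms] False by simp
next
  case True
  let ?X = "{x. x \<noteq> 0 \<and> frob x * x = b / a}"
  have "card ?X \<in> {0, 1, 2, 3}"
    using card_zeros_cases[OF chord_point_nonzero[OF assms]]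
    unfolding card_zeros_chord_eq[OF assms] .
  then have le: "card ?X \<le> 3"
    by (elim insertE emptyE) linarith+
  show ?thesis
  proof (cases "?X = {}")
    case True
    then show ?thesis using card_zeros_chord_eq[OF assms] \<open>even n\<close> by simp
  next
    case False
    then obtain x where x: "x \<noteq> 0" "frob x * x = b / a" by blast
    obtain w :: 'a where w: "w \<noteq> 1" "w ^ 3 = 1" using cube_root_of_unity[OF True] .
    have "w \<noteq> 0" using w by auto
    have "odd h"
      using coprime_n_h \<open>even n\<close> by (metis gcd_greatest odd_one)
    then have "3 dvd (2::nat) ^ h + 1"
    proof -
      assume "odd h"
      then obtain m where m: "h = 2 * m + 1" by (auto elim: oddE)
      define x where "x = (4::nat) ^ m"
      have "x mod 3 = 1" unfolding x_def by (induction m) (auto simp: mod_mult_right_eq[symmetric])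
      then have "3 dvd 2 * x + 1" by presburger
      moreover have "(2::nat) ^ h = 2 * x" by (simp add: m x_def power_mult)
      ultimately show ?thesis by simp
    qed
    then obtain j where j: "(2::nat) ^ h + 1 = 3 * j" by blast
    \<comment> \<open>The exponent is a multiple of 3, so multiplying a solution by \<open>w\<close>
      gives a solution.\<close>
    have "frob w * w = w ^ (2 ^ h + 1)" by (simp add: frob_def power_add)
    then have fw: "frob w * w = 1" using w(2) by (simp only: j power_mult) simp
    have in_X: "w * z \<in> ?X" if "z \<in> ?X" for z
    proof -
      have "frob (w * z) * (w * z) = (frob w * w) * (frob z * z)" by (simp add: mult_ac)
      also have "\<dots> = b / a" using that fw by simp
      finally show ?thesis using that \<open>w \<noteq> 0\<close> by (simp only: mem_Collect_eq mult_eq_0_iff simp_thms)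
    qed
    have "x \<in> ?X" using x by simp
    then have "{x, w * x, w * (w * x)} \<subseteq> ?X"
      using in_X[of x] in_X[of "w * x"] by (simp only: insert_subset empty_subsetI simp_thms)
    then have "card {x, w * x, w * (w * x)} \<le> card ?X" by (intro card_mono) simp_all
    moreover have "w * w \<noteq> 1"
    proof
      assume "w * w = 1"
      then have "w ^ 3 = w" by (simp add: power3_eq_cube)
      then show False using w by simp
    qed
    then have "card {x, w * x, w * (w * x)} = 3"
      using x(1) w(1) \<open>w \<noteq> 0\<close> by (simp add: mult.assoc[symmetric])
    ultimately show ?thesis using le True card_zeros_chord_eq[OF assms] by simp
  qed
qed

text \<open>If a coefficient vanished, \<open>p\<close> would be zero or a multiple of an arc
  vector, which has exactly one zero.\<close>

lemma chord_coeffs: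
  assumes st: "s \<in> reps" "t \<in> reps" "s \<noteq> t"
    and p: "chord p s t" "p \<noteq> 0" "card (zeros p) \<noteq> 1"
  obtains a b where "a \<noteq> 0" "b \<noteq> 0" "p = a *s curve s + b *s curve t"
proof -
  obtain a b where ab: "p = a *s curve s + b *s curve t"
    using p(1) chord_iff[OF st] by blast
  have "a \<noteq> 0 \<and> b \<noteq> 0"
    using p(2,3) st zeros_curve[of s a] zeros_curve[of t b] unfolding ab by (cases "a = 0"; cases "b = 0") auto
  then show ?thesis using ab that by blast
qed

text \<open>A shared endpoint forces the other endpoints to agree by \<open>e1\<close> or
  \<open>e2\<close>. For disjoint endpoint pairs, the coordinates of \<open>u\<close> and
  \<open>w\<close> relative to \<open>s\<close> and \<open>t\<close> have the same ratio
  \<open>frob x / x\<close>, so \<open>u = w\<close>, which is excluded.\<close>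

lemma chord_unique:
  assumes st: "s \<in> reps" "t \<in> reps" "s \<noteq> t" and uw: "u \<in> reps" "w \<in> reps" "u \<noteq> w"
    and p: "chord p s t" "chord p u w" "p \<noteq> 0" "card (zeros p) \<noteq> 1"
  shows "(u, w) = (s, t) \<or> (u, w) = (t, s)"
proof -
  obtain a b where ab: "a \<noteq> 0" "b \<noteq> 0" "p = a *s curve s + b *s curve t"
    using chord_coeffs[OF st p(1,3,4)] .
  have e1: "a * (br s u * frob (br s w)) = b * (br t u * frob (br t w))"
    and e2: "a * (br s w * frob (br s u)) = b * (br t w * frob (br t u))"
    using p(2) unfolding chord_def ab(3)
    by (simp_all only: alt_form_linear alt_form_curve_ten add_eq_0 br_commute[of _ s] br_commute[of _ t])
  consider "u = s" | "u = t" | "w = s" | "w = t" | "{u, w} \<inter> {s, t} = {}" by blast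
  then show ?thesis
  proof cases
    case 5
    then have nz: "br s u \<noteq> 0" "br t u \<noteq> 0" "br s w \<noteq> 0" "br t w \<noteq> 0"
      using st uw by (auto simp: br_eq_0_iff)
    let ?x = "br s u / br t u" and ?y = "br s w / br t w"
    have "frob ?x * ?y = b / a" "?x * frob ?y = b / a"
      using e1 e2 nz ab by (simp_all add: field_simps)
    then have "?x = ?y" using nz frob_ratio_inj[of ?x ?y] by simp
    then have "u = w"
      using ratio_bij[OF st] 5 uw by (auto simp: bij_betw_def dest: inj_onD)
    then show ?thesis using uw by simp
  qed (use e1 e2 ab st uw in \<open>simp_all add: br_eq_0_iff\<close>)
qed

end

subsection \<open>Moments of the number of zeros\<close>

text \<open>Rank-nullity as a bijection: with \<open>y0\<close> scaled to form value 1, each vector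
  of \<open>S\<close> splits uniquely into a multiple of it and a kernel vector.\<close>

lemma card_subspace_kernel:
  fixes S :: "('a::{field,finite} ^ 4) set"
  assumes S: "vec.subspace S" and y0: "y0 \<in> S" "alt_form p y0 \<noteq> 0"
  shows "card S = CARD('a) * card {y \<in> S. alt_form p y = 0}"
proof -
  define z where "z = inverse (alt_form p y0) *s y0"
  have z: "z \<in> S" "alt_form p z = 1"
    using y0 S by (simp_all add: z_def vec.subspace_scale)
  have "bij_betw (\<lambda>(c, y). c *s z + y) (UNIV \<times> {y \<in> S. alt_form p y = 0}) S"
    by (rule bij_betwI[where g = "\<lambda>y. (alt_form p y, y + (- alt_form p y) *s z)"])
      (use z S in \<open>auto simp: vec.subspace_add vec.subspace_scale vec.subspace_diff\<close>)
  then show ?thesis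
    by (simp add: bij_betw_same_card[symmetric] card_cartesian_product)
qed

lemma subspace_alt_form: "vec.subspace S \<Longrightarrow> vec.subspace {y \<in> S. alt_form p y = 0}"
  by (auto simp: vec.subspace_def)

lemma card_offdiag:
  "finite A \<Longrightarrow> card (Sigma A (\<lambda>s. A - {s})) = card A * (card A - 1)"
  by simp

context even_field
begin

abbreviation weight_count :: "('a ^ 4) set \<Rightarrow> nat \<Rightarrow> nat" where
  "weight_count S i \<equiv> card {y \<in> S - {0}. card (zeros y) = i}"

text \<open>The term at \<open>CARD('a) + 1\<close> comes from the zero vector, on which every
  osculating condition holds. The function \<open>f\<close> is left open so that each moment is an
  instance.\<close>

lemma sum_card_zeros:
  fixes f :: "nat \<Rightarrow> nat"
  assumes "0 \<in> S"
  shows "(\<Sum>y\<in>S. f (card (zeros y))) = f (CARD('a) + 1) + f 0 * weight_count S 0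
    + f 1 * weight_count S 1 + f 2 * weight_count S 2 + f 3 * weight_count S 3"
proof -
  have "(\<Sum>y\<in>S - {0}. f (card (zeros y))) =
      (\<Sum>i\<in>{0, 1, 2, 3}. \<Sum>y\<in>{y \<in> S - {0}. card (zeros y) = i}. f (card (zeros y)))"
    by (intro sum.group[symmetric] image_subsetI card_zeros_cases) simp_all
  also have "\<dots> = (\<Sum>i\<in>{0, 1, 2, 3}. \<Sum>y\<in>{y \<in> S - {0}. card (zeros y) = i}. f i)"
    by (intro sum.cong) auto
  finally show ?thesis
    using assms by (simp add: sum.remove[of S 0] zeros_0 card_reps algebra_simps)
qed

lemma weight_count_moment_0:
  assumes "0 \<in> S"
  shows "card S = 1 + weight_count S 0 + weight_count S 1 + weight_count S 2 + weight_count S 3"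
  using sum_card_zeros[OF assms, of "\<lambda>_. 1"] by simp

text \<open>Double counting of pairs of a parameter and a vector of \<open>S\<close> on its
  osculating plane.\<close>

lemma weight_count_moment_1:
  assumes "0 \<in> S"
  shows "(\<Sum>s\<in>reps. card {y \<in> S. alt_form (curve s) y = 0}) =
    CARD('a) + 1 + weight_count S 1 + 2 * weight_count S 2 + 3 * weight_count S 3"
proof -
  have "(\<Sum>s\<in>reps. card {y \<in> S. alt_form (curve s) y = 0}) = (\<Sum>y\<in>S. card (zeros y))"
    by (rule sum_multicount_gen) (auto simp: zeros_def)
  then show ?thesis using sum_card_zeros[OF assms, of "\<lambda>i. i"] by simp
qed

definition pairs :: "(('a \<times> 'a) \<times> ('a \<times> 'a)) set" where
  "pairs = Sigma reps (\<lambda>s. reps - {s})"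

lemma pairs_iff [simp]: "(s, t) \<in> pairs \<longleftrightarrow> s \<in> reps \<and> t \<in> reps \<and> s \<noteq> t"
  by (auto simp: pairs_def)

lemma card_pairs: "card pairs = (CARD('a) + 1) * CARD('a)"
  by (simp add: pairs_def card_reps)

text \<open>The same double count with ordered pairs of distinct parameters, so a vector with
  \<open>i\<close> zeros counts \<open>i * (i - 1)\<close> times.\<close>

lemma weight_count_moment_2:
  assumes "0 \<in> S"
  shows "(\<Sum>st\<in>pairs.
      card {y \<in> S. alt_form (curve (fst st)) y = 0 \<and> alt_form (curve (snd st)) y = 0}) =
    (CARD('a) + 1) * CARD('a) + 2 * weight_count S 2 + 6 * weight_count S 3"
proof -
  have eq: "{st \<in> pairs.
      alt_form (curve (fst st)) y = 0 \<and> alt_form (curve (snd st)) y = 0} =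
    Sigma (zeros y) (\<lambda>s. zeros y - {s})" for y
    by (auto simp: zeros_def pairs_def)
  have "(\<Sum>st\<in>pairs.
      card {y \<in> S. alt_form (curve (fst st)) y = 0 \<and> alt_form (curve (snd st)) y = 0}) =
    (\<Sum>y\<in>S. card (zeros y) * (card (zeros y) - 1))"
    by (rule sum_multicount_gen) (auto simp only: eq card_offdiag finite)
  then show ?thesis using sum_card_zeros[OF assms, of "\<lambda>i. i * (i - 1)"] by simp
qed

lemma reps_other: "s \<in> reps \<Longrightarrow> \<exists>t\<in>reps. t \<noteq> (s :: 'a \<times> 'a)"
  by (auto simp: reps_def)

lemma card_osculating:
  assumes "s \<in> reps"
  shows "card {y. alt_form (curve s) y = 0} = CARD('a) ^ 3"
proof -
  obtain t where t: "t \<in> reps" "t \<noteq> s" using reps_other[OF assms] by blast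
  have "card (UNIV :: ('a ^ 4) set) = CARD('a) * card {y \<in> UNIV. alt_form (curve s) y = 0}"
    by (rule card_subspace_kernel[where ?y0.0 = "curve t"])
      (use assms t in \<open>auto simp: alt_form_curve_curve br_eq_0_iff\<close>)
  then show ?thesis using two_le_card by (simp add: CARD_vec numeral_eq_Suc)
qed

lemma card_osculating_pair:
  assumes "s \<in> reps" "t \<in> reps" "s \<noteq> t"
  shows "card {y. alt_form (curve s) y = 0 \<and> alt_form (curve t) y = 0} = CARD('a) ^ 2"
proof -
  have "card {y \<in> UNIV. alt_form (curve s) y = 0} =
      CARD('a) * card {y \<in> {y \<in> UNIV. alt_form (curve s) y = 0}. alt_form (curve t) y = 0}"
    by (rule card_subspace_kernel[where ?y0.0 = "curve s"])
      (use assms subspace_alt_form[of UNIV "curve s"] in \<open>auto simp: alt_form_curve_curve br_eq_0_iff\<close>)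
  then show ?thesis using two_le_card card_osculating[OF assms(1)] by (simp add: numeral_eq_Suc)
qed

lemma card_plane:
  fixes p :: "'a ^ 4"
  assumes "p \<noteq> 0"
  shows "card {y. alt_form p y = 0} = CARD('a) ^ 3"
proof -
  obtain y where "alt_form p y \<noteq> 0" using alt_form_nondegenerate assms by blast
  then have "card (UNIV :: ('a ^ 4) set) = CARD('a) * card {y \<in> UNIV. alt_form p y = 0}"
    by (intro card_subspace_kernel[of UNIV y p]) auto
  then show ?thesis using two_le_card by (simp add: CARD_vec numeral_eq_Suc)
qed

text \<open>The two planes are distinct: otherwise \<open>p\<close> would be a multiple of
  \<open>curve s\<close> and have exactly one zero.\<close>

lemma card_plane_osculating:
  assumes p: "p \<noteq> 0" "card (zeros p) \<noteq> 1" and s: "s \<in> reps"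
  shows "card {y. alt_form p y = 0 \<and> alt_form (curve s) y = 0} = CARD('a) ^ 2"
proof -
  obtain t where t: "t \<in> reps" "t \<noteq> s" using reps_other[OF s] by blast
  have "\<exists>y. alt_form (curve s) y = 0 \<and> alt_form p y \<noteq> 0"
  proof (rule ccontr)
    assume *: "\<nexists>y. alt_form (curve s) y = 0 \<and> alt_form p y \<noteq> 0"
    have "alt_form p (curve s) = 0" "alt_form p (ten s (fr t)) = 0" "alt_form p (ten t (fr s)) = 0"
      using * by (auto simp: alt_form_curve_curve alt_form_curve_ten)
    then obtain k where "p = k *s curve s"
      using fr_decomposition[OF s t(1), of p] t by auto
    then show False using p zeros_curve[OF s, of k] by (cases "k = 0") auto
  qed
  then obtain y where y: "alt_form (curve s) y = 0" "alt_form p y \<noteq> 0" by blast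
  have "card {y \<in> UNIV. alt_form (curve s) y = 0} =
      CARD('a) * card {y \<in> {y \<in> UNIV. alt_form (curve s) y = 0}. alt_form p y = 0}"
    by (rule card_subspace_kernel[where ?y0.0 = y]) (use y subspace_alt_form[of UNIV] in auto)
  moreover have "{y \<in> {y \<in> UNIV. alt_form (curve s) y = 0}. alt_form p y = 0} =
      {y. alt_form p y = 0 \<and> alt_form (curve s) y = 0}"
    by auto
  ultimately show ?thesis using two_le_card card_osculating[OF s]
    by (simp add: numeral_eq_Suc)
qed

text \<open>The two osculating planes meet in the line spanned by \<open>ten s (fr t)\<close> and
  \<open>ten t (fr s)\<close>. The plane polar to \<open>p\<close> contains this line exactly when
  \<open>chord p s t\<close> holds.\<close>

lemma card_plane_osculating_pair:
  assumes st: "s \<in> reps" "t \<in> reps" "s \<noteq> t"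
  shows "card {y. alt_form p y = 0 \<and> alt_form (curve s) y = 0 \<and> alt_form (curve t) y = 0} =
    (if chord p s t then CARD('a) ^ 2 else CARD('a))"
proof (cases "chord p s t")
  case True
  then obtain a b where "p = a *s curve s + b *s curve t"
    using chord_iff[OF st] by blast
  then have "{y. alt_form p y = 0 \<and> alt_form (curve s) y = 0 \<and> alt_form (curve t) y = 0} =
      {y. alt_form (curve s) y = 0 \<and> alt_form (curve t) y = 0}"
    by auto
  then show ?thesis using True card_osculating_pair[OF st] by simp
next
  case False
  let ?S = "{y \<in> {y \<in> UNIV. alt_form (curve s) y = 0}. alt_form (curve t) y = 0}"
  have "ten s (fr t) \<in> ?S" "ten t (fr s) \<in> ?S" by (simp_all add: alt_form_curve_ten)
  then obtain y where "y \<in> ?S" "alt_form p y \<noteq> 0"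
    using False unfolding chord_def by blast
  then have "card ?S = CARD('a) * card {y \<in> ?S. alt_form p y = 0}"
    by (intro card_subspace_kernel subspace_alt_form) auto
  moreover have "{y \<in> ?S. alt_form p y = 0} =
      {y. alt_form p y = 0 \<and> alt_form (curve s) y = 0 \<and> alt_form (curve t) y = 0}"
    by auto
  moreover have "?S = {y. alt_form (curve s) y = 0 \<and> alt_form (curve t) y = 0}" by auto
  ultimately show ?thesis
    using False two_le_card card_osculating_pair[OF st] by (simp add: power2_eq_square)
qed


section \<open>Points on exactly two osculating planes\<close>

text \<open>The zeros recover the unordered pair; the form value against \<open>ten t (fr s)\<close>
  then detects both the order and the scalar.\<close>

lemma ten_scale_inj:
  assumes "s \<in> reps" "t \<in> reps" "s \<noteq> t" "s' \<in> reps" "t' \<in> reps" "k \<noteq> 0" "k' \<noteq> 0"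
    and eq: "k *s ten s (fr t) = k' *s ten s' (fr t')"
  shows "s = s' \<and> t = t' \<and> k = k'"
proof -
  have "{s, t} = {s', t'}"
    using zeros_ten[of s t k] zeros_ten[of s' t' k'] assms by simp
  then have "s' = s \<and> t' = t \<or> s' = t \<and> t' = s" by (auto simp: doubleton_eq_iff)
  moreover have "alt_form (k *s ten s (fr t)) (ten t (fr s)) = alt_form (k' *s ten s' (fr t')) (ten t (fr s))"
    using eq by simp
  ultimately show ?thesis
    using assms(1-7) by (auto simp: br_eq_0_iff)
qed

lemma weight_count_2:
  "weight_count {y. alt_form p y = 0} 2 =
    card {st \<in> pairs. alt_form p (ten (fst st) (fr (snd st))) = 0} * (CARD('a) - 1)"
proof -
  let ?A = "{st \<in> pairs. alt_form p (ten (fst st) (fr (snd st))) = 0}"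
  have "{y \<in> {y. alt_form p y = 0} - {0}. card (zeros y) = 2} =
      (\<lambda>(st, k). k *s ten (fst st) (fr (snd st))) ` (?A \<times> -{0})"
  proof (intro set_eqI iffI)
    fix y assume "y \<in> {y \<in> {y. alt_form p y = 0} - {0}. card (zeros y) = 2}"
    then have y: "y \<noteq> 0" "alt_form p y = 0" "card (zeros y) = 2" by auto
    then obtain s t k where *: "s \<in> reps" "t \<in> reps" "s \<noteq> t" "k \<noteq> 0" "y = k *s ten s (fr t)"
      using card_zeros_eq_2 by blast
    then show "y \<in> (\<lambda>(st, k). k *s ten (fst st) (fr (snd st))) ` (?A \<times> -{0})"
      using y(2) by (intro image_eqI[where x = "((s, t), k)"]) auto
  next
    fix y assume "y \<in> (\<lambda>(st, k). k *s ten (fst st) (fr (snd st))) ` (?A \<times> -{0})"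
    then obtain x where x: "x \<in> ?A \<times> -{0}" "y = (\<lambda>(st, k). k *s ten (fst st) (fr (snd st))) x"
      by (rule imageE)
    obtain st k where "x = (st, k)" by (cases x)
    with x have st: "st \<in> ?A" "k \<noteq> 0" "y = k *s ten (fst st) (fr (snd st))"
      by simp_all
    obtain s t where "st = (s, t)" by (cases st)
    with st have *: "s \<in> reps" "t \<in> reps" "s \<noteq> t" "k \<noteq> 0" "y = k *s ten s (fr t)"
      "alt_form p (ten s (fr t)) = 0"
      by simp_all
    have z: "zeros y = {s, t}" using * by (simp add: zeros_ten)
    have "y \<noteq> 0"
    proof
      assume "y = 0"
      then have "card {s, t} = CARD('a) + 1" using z zeros_0 card_reps[where ?'a = 'a] by simp
      then show False using *(3) two_le_card by simp
    qed
    then show "y \<in> {y \<in> {y. alt_form p y = 0} - {0}. card (zeros y) = 2}"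
      using z * by simp
  qed
  moreover have "inj_on (\<lambda>(st, k). k *s ten (fst st) (fr (snd st))) (?A \<times> -{0})"
  proof (rule inj_onI)
    fix x x' assume a: "x \<in> ?A \<times> -{0}" "x' \<in> ?A \<times> -{0}"
      "(\<lambda>(st, k). k *s ten (fst st) (fr (snd st))) x = (\<lambda>(st, k). k *s ten (fst st) (fr (snd st))) x'"
    obtain s t k s' t' k' where x: "x = ((s, t), k)" "x' = ((s', t'), k')"
      by (metis surj_pair)
    show "x = x'"
      using ten_scale_inj[of s t s' t' k k'] a unfolding x by simp
  qed
  ultimately show ?thesis
    by (simp add: card_image card_cartesian_product card_nonzero)
qed

text \<open>For fixed \<open>s\<close> the condition is a linear equation in \<open>fr t\<close>. If
  it is not trivial, it has one projective solution, as \<open>frob\<close> is bijective.\<close>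

lemma card_conjugate_unique:
  assumes p: "p \<noteq> 0" "card (zeros p) \<in> {0, 3}" and s: "s \<in> reps"
  shows "card {t \<in> reps. alt_form p (ten s (fr t)) = 0} = 1"
proof -
  define c where "c = alt_form p (ten s (1, 0))"
  define d where "d = alt_form p (ten s (0, 1))"
  have form: "alt_form p (ten s (fr t)) = c * frob (fst t) + d * frob (snd t)" for t
    by (simp add: c_def d_def alt_form_def ten_def fr_def algebra_simps)
  have "c \<noteq> 0 \<or> d \<noteq> 0"
  proof (rule ccontr)
    assume "\<not> (c \<noteq> 0 \<or> d \<noteq> 0)"
    then have zero: "alt_form p (ten s (fr t)) = 0" for t by (simp add: form)
    then have sz: "s \<in> zeros p"
      using s by (simp add: zeros_def curve_def alt_form_commute)
    then have z3: "card (zeros p) = 3" using p by auto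
    have "zeros p \<noteq> {s}" using z3 by auto
    then obtain u where u: "u \<in> zeros p" "u \<noteq> s" using sz by blast
    then have "alt_form p (curve u) = 0" "alt_form p (curve s) = 0" "u \<in> reps"
      using sz by (auto simp: zeros_def alt_form_commute)
    \<comment> \<open>Only the coefficient of \<open>ten s (fr u)\<close> survives, but such a
      vector has two zeros or is 0, contrary to \<open>z3\<close> and \<open>p\<close>.\<close>
    then obtain k where "p = k *s ten s (fr u)"
      using fr_decomposition[OF s \<open>u \<in> reps\<close>, of p] u zero by auto
    then show False
      using p z3 u s zeros_ten[of s u k] \<open>u \<in> reps\<close> by (cases "k = 0") auto
  qed
  then have "\<exists>x. {t \<in> reps. alt_form p (ten s (fr t)) = 0} = {x}"
  proof (cases "d = 0")
    case True
    then have "{t \<in> reps. alt_form p (ten s (fr t)) = 0} = {(0, 1)}"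
      using \<open>c \<noteq> 0 \<or> d \<noteq> 0\<close> by (auto simp: form reps_def)
    then show ?thesis by blast
  next
    case False
    obtain x where x: "frob x = c / d" using bij_frob by (metis bij_pointE)
    have "c + d * frob y = 0 \<longleftrightarrow> frob y = c / d" for y
      using False by (auto simp: add_eq_0 eq_divide_eq mult.commute)
    then have "c + d * frob y = 0 \<longleftrightarrow> y = x" for y by (simp add: x[symmetric])
    then have "alt_form p (ten s (fr (1, y))) = 0 \<longleftrightarrow> y = x" for y by (simp add: form)
    moreover have "alt_form p (ten s (fr (0, 1))) \<noteq> 0" using False by (simp add: form)
    ultimately have "{t \<in> reps. alt_form p (ten s (fr t)) = 0} = {(1, x)}"
      unfolding reps_def by blast
    then show ?thesis by blast
  qed
  then show ?thesis by auto
qed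

text \<open>Each \<open>s\<close> has one conjugate \<open>t\<close>, and it equals \<open>s\<close>
  exactly when \<open>s\<close> is a zero of \<open>p\<close>; only the other parameters contribute
  a pair.\<close>

lemma weight_count_2_plane:
  assumes p: "p \<noteq> 0" "card (zeros p) \<in> {0, 3}"
  shows "weight_count {y. alt_form p y = 0} 2 = (CARD('a) + 1 - card (zeros p)) * (CARD('a) - 1)"
proof -
  let ?T = "\<lambda>s. {t \<in> reps. alt_form p (ten s (fr t)) = 0}"
  have "card (?T s - {s}) = (if s \<in> zeros p then 0 else 1)" if "s \<in> reps" for s
  proof -
    have "s \<in> zeros p \<longleftrightarrow> s \<in> ?T s"
      using that by (simp add: zeros_def curve_def alt_form_commute)
    then show ?thesis using card_conjugate_unique[OF p that] by simp
  qed
  then have "(\<Sum>s\<in>reps. card (?T s - {s})) = (\<Sum>s\<in>reps. if s \<in> zeros p then 0 else 1)"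
    by simp
  also have "\<dots> = card (reps - zeros p)"
    by (simp add: sum.If_cases Diff_eq)
  also have "\<dots> = CARD('a) + 1 - card (zeros p)"
    using zeros_subset[of p] by (simp add: card_Diff_subset card_reps)
  also have "(\<Sum>s\<in>reps. card (?T s - {s})) = card (Sigma reps (\<lambda>s. ?T s - {s}))"
    by simp
  also have "Sigma reps (\<lambda>s. ?T s - {s}) = {st \<in> pairs. alt_form p (ten (fst st) (fr (snd st))) = 0}"
    by (auto simp: pairs_def)
  finally show ?thesis by (simp only: weight_count_2)
qed

text \<open>Combine the moments with weight \<open>2 - 2 * i + i * (i - 1)\<close>, that is
  \<open>(i - 1) * (i - 2)\<close>: it is 2 at 0 and 3 and vanishes at 1 and 2.\<close>

lemma weight_count_UNIV:
  "2 * (weight_count UNIV 0 + weight_count UNIV 3) = (CARD('a) + 1) * CARD('a) * (CARD('a) - 1)\<^sup>2"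
proof -
  have m0: "CARD('a) ^ 4 = 1 + weight_count UNIV 0 + weight_count UNIV 1
      + weight_count UNIV 2 + weight_count UNIV 3"
    using weight_count_moment_0[of UNIV] by (simp add: CARD_vec)
  have m1: "(CARD('a) + 1) * CARD('a) ^ 3 =
      CARD('a) + 1 + weight_count UNIV 1 + 2 * weight_count UNIV 2 + 3 * weight_count UNIV 3"
    using weight_count_moment_1[of UNIV] by (simp add: card_osculating card_reps)
  have "(\<Sum>st\<in>pairs. card {y \<in> UNIV. alt_form (curve (fst st)) y = 0 \<and> alt_form (curve (snd st)) y = 0})
      = (\<Sum>st\<in>pairs. CARD('a) ^ 2)"
  proof (rule sum.cong)
    fix st assume "st \<in> pairs"
    then show "card {y \<in> UNIV. alt_form (curve (fst st)) y = 0 \<and> alt_form (curve (snd st)) y = 0} = CARD('a) ^ 2"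
      using card_osculating_pair[of "fst st" "snd st"] by (cases st) (simp only: pairs_iff fst_conv snd_conv UNIV_I simp_thms)
  qed simp
  then have m3: "(CARD('a) + 1) * CARD('a) ^ 3 =
      (CARD('a) + 1) * CARD('a) + 2 * weight_count UNIV 2 + 6 * weight_count UNIV 3"
    using weight_count_moment_2[of UNIV] card_pairs by (simp add: power2_eq_square power3_eq_cube algebra_simps)
  define Q where "Q = real CARD('a)"
  have Q: "real (CARD('a) - 1) = Q - 1" using two_le_card by (simp add: Q_def of_nat_diff)
  have "real (2 * (weight_count UNIV 0 + weight_count UNIV 3)) =
      2 * Q ^ 4 - 2 - (Q + 1) * Q ^ 3 + 2 * (Q + 1) - (Q + 1) * Q"
  proof -
    \<comment> \<open>The first and second moment sums are both \<open>(q + 1) * q ^ 3\<close>, so a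
      single \<open>b\<close> serves for both.\<close>
    have "2 * (w0 + w3) = 2 * a - 2 - b + 2 * (Q + 1) - c"
      if "a = 1 + w0 + w1 + w2 + w3" "b = Q + 1 + w1 + 2 * w2 + 3 * w3" "b = c + 2 * w2 + 6 * w3"
      for a b c w0 w1 w2 w3 :: real
    proof -
      have "w1 = b - (Q + 1) - 2 * w2 - 3 * w3" "c = b - 2 * w2 - 6 * w3"
        using that(2,3) by simp_all
      then show ?thesis unfolding that(1) by simp
    qed
    from this[OF arg_cong[OF m0, of real, unfolded of_nat_add of_nat_1]
        arg_cong[OF m1, of real, unfolded of_nat_add of_nat_1 of_nat_mult of_nat_numeral, folded Q_def]
        arg_cong[OF m3, of real, unfolded of_nat_add of_nat_1 of_nat_mult of_nat_numeral, folded Q_def]]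
    show ?thesis by (simp add: Q_def)
  qed
  also have "\<dots> = (Q + 1) * Q * (Q - 1)\<^sup>2"
    by (simp add: algebra_simps power2_eq_square power3_eq_cube power4_eq_xxxx)
  also have "\<dots> = real ((CARD('a) + 1) * CARD('a) * (CARD('a) - 1)\<^sup>2)"
    unfolding of_nat_mult of_nat_power of_nat_add Q Q_def by simp
  finally show ?thesis by (simp only: of_nat_eq_iff)
qed


section \<open>Number of chords through a point and the resulting plane counts\<close>

text \<open>Ordered pairs, so each chord through \<open>p\<close> is counted twice.\<close>

definition chord_count :: "'a ^ 4 \<Rightarrow> nat" where
  "chord_count p = card {st \<in> pairs. chord p (fst st) (snd st)}"

lemma chord_count_odd:
  assumes p: "p \<noteq> 0" "card (zeros p) \<noteq> 1" and "odd n"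
  shows "chord_count p = 0"
proof -
  have "\<not> chord p s t" if st: "s \<in> reps" "t \<in> reps" "s \<noteq> t" for s t
  proof
    assume "chord p s t"
    then obtain a b where ab: "a \<noteq> 0" "b \<noteq> 0" "p = a *s curve s + b *s curve t"
      using chord_coeffs[OF st _ p] by blast
    show False using card_zeros_chord[OF st ab(1,2)] ab(3) p(2) \<open>odd n\<close> by simp
  qed
  then have "{st \<in> pairs. chord p (fst st) (snd st)} = {}" by fastforce
  then show ?thesis by (simp only: chord_count_def card.empty)
qed

lemma chord_count_le_2:
  assumes p: "p \<noteq> 0" "card (zeros p) \<noteq> 1"
  shows "chord_count p \<le> 2"
proof (cases "{st \<in> pairs. chord p (fst st) (snd st)} = {}")
  case True
  then show ?thesis by (simp only: chord_count_def card.empty)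
next
  case False
  then obtain st where st: "st \<in> pairs" "chord p (fst st) (snd st)" by blast
  obtain s t where "st = (s, t)" by (cases st)
  then have *: "s \<in> reps" "t \<in> reps" "s \<noteq> t" "chord p s t"
    using st by simp_all
  have "{st \<in> pairs. chord p (fst st) (snd st)} \<subseteq> {(s, t), (t, s)}"
  proof
    fix x assume x: "x \<in> {st \<in> pairs. chord p (fst st) (snd st)}"
    obtain u w where "x = (u, w)" by (cases x)
    then have "u \<in> reps" "w \<in> reps" "u \<noteq> w" "chord p u w"
      using x by simp_all
    then show "x \<in> {(s, t), (t, s)}"
      using chord_unique[OF *(1-3) _ _ _ *(4) _ p] \<open>x = (u, w)\<close> by blast
  qed
  then have "card {st \<in> pairs. chord p (fst st) (snd st)} \<le> card {(s, t), (t, s)}"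
    by (intro card_mono) simp_all
  also have "\<dots> = 2" using *(3) by simp
  finally show ?thesis by (simp only: chord_count_def)
qed

lemma curve_pair_inj:
  assumes st: "s \<in> reps" "t \<in> reps" "s \<noteq> t"
    and eq: "a *s curve s + b *s curve t = c *s curve s + d *s curve t"
  shows "a = c \<and> b = d"
proof -
  have "alt_form (curve s) (a *s curve s + b *s curve t) = alt_form (curve s) (c *s curve s + d *s curve t)"
    "alt_form (curve t) (a *s curve s + b *s curve t) = alt_form (curve t) (c *s curve s + d *s curve t)"
    using eq by simp_all
  then show ?thesis
    using st br_eq_0_iff[of s t] br_eq_0_iff[of t s] by (simp add: alt_form_curve_curve)
qed

text \<open>By \<open>weight_count_UNIV\<close>, the chords cover on average two ordered pairs \<open>(s, t)\<close> per point of this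
  kind, which is also the maximum.\<close>

lemma chord_count_even:
  assumes p: "p \<noteq> 0" "card (zeros p) \<in> {0, 3}" and "even n"
  shows "chord_count p = 2"
proof -
  define C where "C = {p :: 'a ^ 4. p \<noteq> 0 \<and> card (zeros p) \<in> {0, 3}}"
  \<comment> \<open>For even \<open>n\<close> all vectors of a chord off its two endpoints belong to
    \<open>C\<close>, by \<open>card_zeros_chord\<close>.\<close>
  have on_chord: "card {p \<in> C. chord p (fst st) (snd st)} = (CARD('a) - 1)\<^sup>2" if "st \<in> pairs" for st
  proof -
    obtain s t where st': "st = (s, t)" by (cases st)
    then have st: "s \<in> reps" "t \<in> reps" "s \<noteq> t" using that by simp_all
    have "{p \<in> C. chord p s t} = (\<lambda>(a, b). a *s curve s + b *s curve t) ` ((-{0}) \<times> -{0})"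
    proof (intro set_eqI iffI)
      fix p assume "p \<in> {p \<in> C. chord p s t}"
      then have "p \<noteq> 0" "card (zeros p) \<noteq> 1" "chord p s t" by (auto simp: C_def)
      then obtain a b where "a \<noteq> 0" "b \<noteq> 0" "p = a *s curve s + b *s curve t"
        using chord_coeffs[OF st] by blast
      then show "p \<in> (\<lambda>(a, b). a *s curve s + b *s curve t) ` ((-{0}) \<times> -{0})"
        by (intro image_eqI[where x = "(a, b)"]) simp_all
    next
      fix p assume "p \<in> (\<lambda>(a, b). a *s curve s + b *s curve t) ` ((-{0}) \<times> -{0})"
      then obtain a b where ab: "a \<noteq> 0" "b \<noteq> 0" "p = a *s curve s + b *s curve t" by auto
      then show "p \<in> {p \<in> C. chord p s t}"
        using card_zeros_chord[OF st ab(1,2)] chord_point_nonzero[OF st ab(1,2)] \<open>even n\<close>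
        unfolding C_def chord_iff[OF st] by auto
    qed
    moreover have "inj_on (\<lambda>(a, b). a *s curve s + b *s curve t) ((-{0}) \<times> -{0})"
      using curve_pair_inj[OF st] by (auto simp: inj_on_def)
    ultimately show ?thesis
      by (simp add: st' card_image card_cartesian_product card_nonzero power2_eq_square)
  qed
  have "(\<Sum>p\<in>C. chord_count p) = (\<Sum>st\<in>pairs. card {p \<in> C. chord p (fst st) (snd st)})"
    unfolding chord_count_def by (rule sum_multicount_gen) simp_all
  also have "\<dots> = (\<Sum>st\<in>pairs. (CARD('a) - 1)\<^sup>2)"
    by (rule sum.cong[OF refl on_chord])
  also have "\<dots> = 2 * (weight_count UNIV 0 + weight_count UNIV 3)"
    unfolding weight_count_UNIV sum_constant card_pairs of_nat_id by simp
  also have "weight_count UNIV 0 + weight_count UNIV 3 = card C"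
    unfolding C_def by (subst card_Un_disjoint[symmetric]) (auto intro!: arg_cong[where f = card])
  also have "2 * card C = (\<Sum>p\<in>C. 2)"
    by simp
  finally have "(\<Sum>p\<in>C. chord_count p) = (\<Sum>p\<in>C. 2)" .
  moreover have "chord_count p \<le> 2" if "p \<in> C" for p
    using that chord_count_le_2 by (auto simp: C_def)
  ultimately show ?thesis
    using sum_mono_inv[of chord_count C "\<lambda>_. 2" p] p by (simp add: C_def)
qed

text \<open>The sign of the residue of \<open>2 ^ n\<close> modulo 3. It makes \<open>1 + xi\<close>
  the value of \<open>chord_count\<close> for either parity.\<close>

definition xi :: real where "xi = (if even n then 1 else -1)"

lemma chord_count_eq:
  assumes "p \<noteq> 0" "card (zeros p) \<in> {0, 3}"
  shows "real (chord_count p) = 1 + xi"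
  using chord_count_even[OF assms] chord_count_odd[OF assms(1)] assms(2)
  by (cases "even n") (auto simp: xi_def)

text \<open>Weight 2 is known from \<open>weight_count_2_plane\<close>; the second, first and zeroth
  moments then give weights 3, 1 and 0 in turn. The factor \<open>Q - 1\<close> passes from points
  to vectors, and the summand \<open>z\<close> in weight 1 stands for the arc points in the
  plane.\<close>

lemma weight_count_plane:
  fixes p :: "'a ^ 4"
  assumes p: "p \<noteq> 0" "card (zeros p) \<in> {0, 3}"
  defines "W \<equiv> {y. alt_form p y = 0}" and "Q \<equiv> real CARD('a)" and "z \<equiv> real (card (zeros p))"
  shows "real (weight_count W 0) = (Q - 1) * ((Q\<^sup>2 + xi * Q + 1 - z) / 3)"
    and "real (weight_count W 1) = (Q - 1) * (Q * (Q - xi) / 2 + z)"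
    and "real (weight_count W 2) = (Q - 1) * (Q + 1 - z)"
    and "real (weight_count W 3) = (Q - 1) * ((Q\<^sup>2 + xi * Q - 2 + 2 * z) / 6)"
proof -
  have Q: "real (CARD('a) - 1) = Q - 1" using two_le_card by (simp add: Q_def of_nat_diff)
  have "card (zeros p) \<le> CARD('a) + 1" using p two_le_card by auto
  then have m2: "real (weight_count W 2) = (Q + 1 - z) * (Q - 1)"
    unfolding W_def weight_count_2_plane[OF p] of_nat_mult Q by (simp add: Q_def z_def of_nat_diff)
  have W0: "0 \<in> W" by (simp add: W_def)
  have p1: "card (zeros p) \<noteq> 1" using p by auto
  have m0: "Q ^ 3 = 1 + real (weight_count W 0) + real (weight_count W 1)
      + real (weight_count W 2) + real (weight_count W 3)"
    using arg_cong[OF weight_count_moment_0[OF W0], of real] card_plane[OF p(1)]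
    by (simp add: W_def Q_def)
  have "(\<Sum>s\<in>reps. card {y \<in> W. alt_form (curve s) y = 0}) = (\<Sum>s\<in>(reps :: ('a \<times> 'a) set). CARD('a) ^ 2)"
    by (intro sum.cong) (simp_all add: W_def card_plane_osculating[OF p(1) p1])
  then have m1: "(Q + 1) * Q\<^sup>2 = Q + 1 + real (weight_count W 1) + 2 * real (weight_count W 2)
      + 3 * real (weight_count W 3)"
    using arg_cong[OF weight_count_moment_1[OF W0], of real] by (simp add: card_reps Q_def distrib_right)
  have "(\<Sum>st\<in>pairs. card {y \<in> W. alt_form (curve (fst st)) y = 0 \<and> alt_form (curve (snd st)) y = 0}) =
      (\<Sum>st\<in>pairs. if chord p (fst st) (snd st) then CARD('a) ^ 2 else CARD('a))"
  proof (rule sum.cong)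
    fix st assume "st \<in> pairs"
    then show "card {y \<in> W. alt_form (curve (fst st)) y = 0 \<and> alt_form (curve (snd st)) y = 0} =
        (if chord p (fst st) (snd st) then CARD('a) ^ 2 else CARD('a))"
      using card_plane_osculating_pair[of "fst st" "snd st" p] unfolding W_def
      by (cases st) simp
  qed simp
  also have "\<dots> = chord_count p * CARD('a) ^ 2 + (card pairs - chord_count p) * CARD('a)"
  proof -
    have "card (pairs \<inter> - {st. chord p (fst st) (snd st)}) = card pairs - chord_count p"
    proof -
      have "pairs \<inter> - {st. chord p (fst st) (snd st)} = pairs - {st \<in> pairs. chord p (fst st) (snd st)}"
        by blast
      then show ?thesis unfolding chord_count_def by (simp add: card_Diff_subset)
    qed
    moreover have "card (pairs \<inter> {st. chord p (fst st) (snd st)}) = chord_count p"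
      unfolding chord_count_def by (auto intro!: arg_cong[where f = card])
    ultimately show ?thesis
      by (simp only: sum.If_cases finite sum_constant of_nat_id)
  qed
  finally have c: "chord_count p * CARD('a) ^ 2 + (card pairs - chord_count p) * CARD('a) =
      (CARD('a) + 1) * CARD('a) + 2 * weight_count W 2 + 6 * weight_count W 3"
    unfolding weight_count_moment_2[OF W0] by simp
  \<comment> \<open>This turns the truncated subtraction into a real one.\<close>
  have le: "chord_count p \<le> card pairs"
    unfolding chord_count_def by (intro card_mono) auto
  have "real (chord_count p) * Q\<^sup>2 + ((Q + 1) * Q - real (chord_count p)) * Q =
      (Q + 1) * Q + 2 * real (weight_count W 2) + 6 * real (weight_count W 3)"
    using arg_cong[OF c, of real] unfolding of_nat_add of_nat_mult of_nat_diff[OF le[unfolded card_pairs]] of_nat_power card_pairs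
      of_nat_1 of_nat_numeral Q_def .
  then have m3: "(1 + xi) * Q\<^sup>2 + ((Q + 1) * Q - (1 + xi)) * Q =
      (Q + 1) * Q + 2 * real (weight_count W 2) + 6 * real (weight_count W 3)"
    unfolding chord_count_eq[OF p] .
  show w2: "real (weight_count W 2) = (Q - 1) * (Q + 1 - z)"
    using m2 by (simp add: mult.commute)
  have "6 * real (weight_count W 3) = (Q - 1) * (Q\<^sup>2 + xi * Q - 2 + 2 * z)"
    using m3 unfolding w2 by (simp add: algebra_simps power2_eq_square)
  then show w3: "real (weight_count W 3) = (Q - 1) * ((Q\<^sup>2 + xi * Q - 2 + 2 * z) / 6)"
    by simp
  have "real (weight_count W 1) = (Q + 1) * Q\<^sup>2 - (Q + 1) - 2 * ((Q - 1) * (Q + 1 - z))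
      - 3 * ((Q - 1) * ((Q\<^sup>2 + xi * Q - 2 + 2 * z) / 6))"
    using m1 unfolding w2 w3 by simp
  also have "\<dots> = (Q - 1) * (Q * (Q - xi) / 2 + z)"
    by (simp add: field_simps power2_eq_square)
  finally show w1: "real (weight_count W 1) = (Q - 1) * (Q * (Q - xi) / 2 + z)" .
  have "real (weight_count W 0) = Q ^ 3 - 1 - (Q - 1) * (Q * (Q - xi) / 2 + z)
      - (Q - 1) * (Q + 1 - z) - (Q - 1) * ((Q\<^sup>2 + xi * Q - 2 + 2 * z) / 6)"
    using m0 unfolding w1 w2 w3 by simp
  also have "\<dots> = (Q - 1) * ((Q\<^sup>2 + xi * Q + 1 - z) / 3)"
    by (simp add: field_simps power2_eq_square power3_eq_cube)
  finally show "real (weight_count W 0) = (Q - 1) * ((Q\<^sup>2 + xi * Q + 1 - z) / 3)" .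
qed

end

subsection \<open>From vectors to points and planes\<close>

lemma mem_hom_point: "y \<in> hom_point x \<longleftrightarrow> (\<exists>k. y = k *s x)"
  unfolding hom_point_def using vec.span_breakdown_eq[of y x "{}"] by simp

lemma mem_hom_point_self: "x \<in> hom_point x"
  unfolding mem_hom_point by (intro exI[of _ 1]) simp

lemma pg_points_iff: "P \<in> pg_points \<longleftrightarrow> (\<exists>x. x \<noteq> 0 \<and> P = hom_point x)"
proof
  assume "P \<in> pg_points"
  then have P: "vec.subspace P" "vec.dim P = 1" by (auto simp: pg_points_def)
  obtain B where B: "B \<subseteq> P" "vec.independent B" "P \<subseteq> vec.span B" "card B = vec.dim P"
    using vec.basis_exists by blast
  then obtain x where x: "B = {x}" using P(2) by (auto simp: card_1_singleton_iff)
  have "x \<noteq> 0" using B(2) x by (simp add: vec.dependent_single)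
  moreover have "P = hom_point x"
    unfolding hom_point_def using B(1,3) P(1) x vec.span_minimal by blast
  ultimately show "\<exists>x. x \<noteq> 0 \<and> P = hom_point x" by blast
next
  assume "\<exists>x. x \<noteq> 0 \<and> P = hom_point x"
  then obtain x where x: "x \<noteq> 0" "P = hom_point x" by blast
  then have "vec.dim P = card {x}"
    unfolding x(2) hom_point_def
    by (intro vec.dim_span_eq_card_independent) (simp add: vec.dependent_single)
  then show "P \<in> pg_points" using x by (simp add: pg_points_def hom_point_def)
qed

lemma hom_point_scale: "k \<noteq> 0 \<Longrightarrow> hom_point (k *s x) = hom_point x"
proof (intro set_eqI iffI)
  fix y assume "k \<noteq> 0" "y \<in> hom_point x"
  then obtain c where "y = c *s x" by (auto simp: mem_hom_point)
  then have "y = (c / k) *s (k *s x)" using \<open>k \<noteq> 0\<close> by (simp add: vector_smult_assoc)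
  then show "y \<in> hom_point (k *s x)" by (auto simp only: mem_hom_point)
qed (auto simp: mem_hom_point vector_smult_assoc)

lemma polar_hom_point: "polar (hom_point x) = {y. alt_form x y = 0}"
proof (intro set_eqI iffI)
  fix y assume "y \<in> polar (hom_point x)"
  with mem_hom_point_self[of x] show "y \<in> {y. alt_form x y = 0}" by (auto simp: polar_def)
qed (auto simp: polar_def mem_hom_point)

lemma hom_point_subset_polar: "hom_point x \<subseteq> polar (hom_point y) \<longleftrightarrow> alt_form x y = 0"
proof
  assume "hom_point x \<subseteq> polar (hom_point y)"
  then have "alt_form y x = 0"
    unfolding polar_hom_point using mem_hom_point_self[of x] by blast
  then show "alt_form x y = 0"
    by (simp only: alt_form_commute[of x y])
next
  assume "alt_form x y = 0"
  then show "hom_point x \<subseteq> polar (hom_point y)"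
    unfolding polar_hom_point by (auto simp: mem_hom_point alt_form_commute[of y])
qed

text \<open>Linear functionals with the same kernel are proportional.\<close>

lemma polar_inj: "inj_on polar pg_points"
proof (rule inj_onI)
  fix P R :: "('a::field ^ 4) set"
  assume PR: "P \<in> pg_points" "R \<in> pg_points" "polar P = polar R"
  obtain x y where x: "x \<noteq> 0" "P = hom_point x" and y: "y \<noteq> 0" "R = hom_point y"
    using PR(1,2) unfolding pg_points_iff by blast
  have eq: "alt_form x u = 0 \<longleftrightarrow> alt_form y u = 0" for u
    using PR(3) unfolding x(2) y(2) polar_hom_point by blast
  obtain w where w: "alt_form x w \<noteq> 0" using alt_form_nondegenerate x(1) by blast
  define k where "k = alt_form y w / alt_form x w"
  have "alt_form (y - k *s x) u = 0" for u
  proof -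
    \<comment> \<open>This combination of \<open>u\<close> and \<open>w\<close> lies in the kernel
      of \<open>x\<close>, hence in that of \<open>y\<close>.\<close>
    have "alt_form x (alt_form x w *s u - alt_form x u *s w) = 0" by simp
    then have "alt_form y (alt_form x w *s u - alt_form x u *s w) = 0" using eq by blast
    then show ?thesis
      using w by (simp add: k_def alt_form_commute[of _ u] field_simps)
  qed
  then have "y = k *s x" using alt_form_nondegenerate[of "y - k *s x"] by simp
  then show "P = R" using x y hom_point_scale[of k x] by (cases "k = 0") simp_all
qed

lemma card_vectors_of_points:
  fixes X :: "('a::{field,finite} ^ 4) set set"
  assumes "X \<subseteq> pg_points"
  shows "card {y. y \<noteq> 0 \<and> hom_point y \<in> X} = (CARD('a) - 1) * card X"
proof -
  have fib: "card {y. y \<noteq> 0 \<and> hom_point y = P} = CARD('a) - 1" if P: "P \<in> X" for P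
  proof -
    obtain x where x: "x \<noteq> 0" "P = hom_point x" using assms P pg_points_iff by blast
    have "{y. y \<noteq> 0 \<and> hom_point y = P} = (\<lambda>k. k *s x) ` (-{0})"
    proof (intro set_eqI iffI)
      fix y assume y: "y \<in> {y. y \<noteq> 0 \<and> hom_point y = P}"
      then have "y \<in> hom_point x" using x(2) mem_hom_point_self[of y] by simp
      then obtain k where "y = k *s x" unfolding mem_hom_point by blast
      then show "y \<in> (\<lambda>k. k *s x) ` (-{0})" using y by auto
    qed (use x in \<open>auto simp: hom_point_scale\<close>)
    moreover have "inj_on (\<lambda>k. k *s x) (-{0})"
      using x(1) by (auto intro: inj_onI)
    ultimately show ?thesis by (simp add: card_image card_nonzero)
  qed
  have "{y. y \<noteq> 0 \<and> hom_point y \<in> X} = (\<Union>P\<in>X. {y. y \<noteq> 0 \<and> hom_point y = P})" by auto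
  then have "card {y. y \<noteq> 0 \<and> hom_point y \<in> X} = (\<Sum>P\<in>X. card {y. y \<noteq> 0 \<and> hom_point y = P})"
    by (simp only:) (intro card_UN_disjoint; auto)
  then show ?thesis using fib by simp
qed

context even_field
begin

lemma arc_eq: "arc h = (\<lambda>s. hom_point (curve s)) ` reps"
proof -
  have "P_point h t = hom_point (curve (1, t))" for t
    by (simp add: P_point_def curve_def ten_def fr_def frob_def mult.commute)
  moreover have "axis 4 1 = curve (0, 1)"
    by (simp add: vec_eq_iff forall_4 curve_def ten_def fr_def axis_def)
  then have "U_point 4 = hom_point (curve (0, 1))" by (simp add: U_point_def)
  ultimately show ?thesis by (auto simp: arc_def reps_def)
qed

lemma curve_nonzero: "s \<in> reps \<Longrightarrow> curve s \<noteq> 0"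
proof
  assume "s \<in> reps" "curve s = 0"
  then have "card (reps :: ('a \<times> 'a) set) = card {s}"
    using zeros_curve[of s 1] zeros_0 by simp
  then show False using card_reps[where ?'a = 'a] two_le_card by simp
qed

lemma arc_subset: "arc h \<subseteq> (pg_points :: ('a ^ 4) set set)"
  unfolding arc_eq by (rule image_subsetI) (use curve_nonzero pg_points_iff in blast)

text \<open>An osculating plane contains no arc point other than its own pole.\<close>

lemma hom_point_curve_inj: "inj_on (\<lambda>s. hom_point (curve s)) reps"
proof (rule inj_onI)
  fix s t assume st: "s \<in> reps" "t \<in> reps" "hom_point (curve s) = hom_point (curve t)"
  have "alt_form (curve s) (curve s) = 0" by (simp add: alt_form_curve_curve)
  then have "alt_form (curve s) (curve t) = 0"
    using st(3) unfolding hom_point_subset_polar[symmetric] by simp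
  then show "s = t" using st by (auto simp: alt_form_curve_curve br_eq_0_iff)
qed

lemma card_arc_polar: "card {R \<in> arc h. hom_point y \<subseteq> polar R} = card (zeros y)"
proof -
  have "{R \<in> arc h. hom_point y \<subseteq> polar R} = (\<lambda>s. hom_point (curve s)) ` zeros y"
    using hom_point_subset_polar[of y] alt_form_commute[of y] unfolding arc_eq zeros_def by fastforce
  moreover have "inj_on (\<lambda>s. hom_point (curve s)) (zeros y)"
    using hom_point_curve_inj zeros_subset by (rule inj_on_subset)
  ultimately show ?thesis by (simp add: card_image)
qed

lemma card_polar_image:
  assumes "X \<subseteq> pg_points"
  shows "card {\<pi> \<in> polar ` X. P \<subseteq> \<pi>} = card {R \<in> X. P \<subseteq> polar R}"
proof -
  have "{\<pi> \<in> polar ` X. P \<subseteq> \<pi>} = polar ` {R \<in> X. P \<subseteq> polar R}" by auto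
  moreover have "inj_on polar {R \<in> X. P \<subseteq> polar R}"
    using polar_inj by (rule inj_on_subset) (use assms in auto)
  ultimately show ?thesis by (simp add: card_image)
qed

lemma card_osculating_planes:
  "card {\<pi> \<in> osculating_planes h. hom_point y \<subseteq> \<pi>} = card (zeros y)"
  unfolding osculating_planes_def card_polar_image[OF arc_subset] card_arc_polar ..

lemma hom_point_in_class:
  assumes "i \<noteq> CARD('a) + 1" "y \<noteq> 0"
  shows "hom_point y \<in> point_class h i \<longleftrightarrow> hom_point y \<notin> arc h \<and> card (zeros y) = i"
  using assms pg_points_iff by (auto simp: point_class_def card_osculating_planes)

lemma point_class_subset: "point_class h i \<subseteq> (pg_points :: ('a ^ 4) set set)"
  using arc_subset by (auto simp: point_class_def)

text \<open>By polarity, planes of a class through a point correspond to points of the class in the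
  polar plane, each carrying \<open>q - 1\<close> nonzero vectors.\<close>

lemma card_plane_class:
  fixes p :: "'a ^ 4"
  shows "(CARD('a) - 1) * card {\<pi> \<in> plane_class h d. hom_point p \<subseteq> \<pi>} =
    card {y. y \<noteq> 0 \<and> alt_form p y = 0 \<and> hom_point y \<in> point_class h d}"
proof -
  have "{y. y \<noteq> 0 \<and> hom_point y \<in> {R \<in> point_class h d. hom_point p \<subseteq> polar R}} =
      {y. y \<noteq> 0 \<and> alt_form p y = 0 \<and> hom_point y \<in> point_class h d}"
    by (auto simp: hom_point_subset_polar)
  moreover have "{R \<in> point_class h d. hom_point p \<subseteq> polar R} \<subseteq> (pg_points :: ('a ^ 4) set set)"
    using point_class_subset by blast
  note card_vectors_of_points[OF this]
  ultimately show ?thesis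
    unfolding plane_class_def card_polar_image[OF point_class_subset] by simp
qed

lemma card_zeros_arc:
  assumes "y \<noteq> 0" "hom_point y \<in> arc h"
  shows "card (zeros y) = 1"
proof -
  obtain s where s: "s \<in> reps" "hom_point y = hom_point (curve s)"
    using assms(2) by (auto simp: arc_eq)
  have "y \<in> hom_point (curve s)" using mem_hom_point_self[of y] unfolding s(2) .
  then obtain k where "y = k *s curve s" unfolding mem_hom_point by blast
  then show ?thesis using zeros_curve[OF s(1), of k] assms(1) by (cases "k = 0") simp_all
qed

text \<open>Arc points lie on one osculating plane, so excluding them affects only the index
  1.\<close>

lemma card_plane_class_weight:
  assumes "d \<noteq> 1" "d \<noteq> CARD('a) + 1"
  shows "(CARD('a) - 1) * card {\<pi> \<in> plane_class h d. hom_point p \<subseteq> \<pi>} =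
    weight_count {y. alt_form p y = 0} d"
proof -
  have "{y. y \<noteq> 0 \<and> alt_form p y = 0 \<and> hom_point y \<in> point_class h d} =
      {y \<in> {y. alt_form p y = 0} - {0}. card (zeros y) = d}"
    using assms card_zeros_arc by (auto simp: hom_point_in_class)
  then show ?thesis unfolding card_plane_class by simp
qed

text \<open>Vectors of weight 1 also come from the arc, which has \<open>card (zeros p)\<close>
  points in the plane.\<close>

lemma card_plane_class_weight_1:
  "(CARD('a) - 1) * (card {\<pi> \<in> plane_class h 1. hom_point p \<subseteq> \<pi>} + card (zeros p)) =
    weight_count {y. alt_form p y = 0} 1"
proof -
  let ?A = "{y. y \<noteq> 0 \<and> alt_form p y = 0 \<and> hom_point y \<in> point_class h 1}"
  let ?B = "{y. y \<noteq> 0 \<and> hom_point y \<in> {R \<in> arc h. hom_point p \<subseteq> polar R}}"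
  have "(1::nat) \<noteq> CARD('a) + 1" using two_le_card by simp
  note cls = hom_point_in_class[OF this]
  have "card ?B = (CARD('a) - 1) * card (zeros p)"
    using card_vectors_of_points[of "{R \<in> arc h. hom_point p \<subseteq> polar R}"] arc_subset card_arc_polar[of p]
    by (metis (no_types, lifting) mem_Collect_eq subset_iff)
  moreover have "?A \<inter> ?B = {}" using cls by blast
  then have "card (?A \<union> ?B) = card ?A + card ?B" by (intro card_Un_disjoint) simp_all
  moreover have "?A \<union> ?B = {y \<in> {y. alt_form p y = 0} - {0}. card (zeros y) = 1}"
    using cls card_zeros_arc by (auto simp: hom_point_subset_polar)
  ultimately show ?thesis unfolding distrib_left card_plane_class by simp
qed

lemma plane_class_counts:
  fixes P :: "('a ^ 4) set" and i :: nat
  assumes i: "i \<in> {0, 3}" "i \<noteq> CARD('a) + 1" and big: "3 < CARD('a) + 1" and P: "P \<in> point_class h i"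
  defines "Q \<equiv> real CARD('a)" and "r \<equiv> \<lambda>d. real (card {\<pi> \<in> plane_class h d. P \<subseteq> \<pi>})"
  shows "r (CARD('a) + 1) = i"
    and "r 0 = (Q\<^sup>2 + xi * Q + 1 - i) / 3"
    and "r 1 = Q * (Q - xi) / 2"
    and "r 2 = Q + 1 - i"
    and "r 3 = (Q\<^sup>2 + xi * Q - 2 + 2 * real i) / 6"
proof -
  obtain p where p: "p \<noteq> 0" "P = hom_point p"
    using P point_class_subset pg_points_iff by blast
  have z: "card (zeros p) = i"
    using P hom_point_in_class[OF i(2) p(1)] p(2) by blast
  have p': "card (zeros p) \<in> {0, 3}" using z i(1) by simp
  have Q1: "real (CARD('a) - 1) = Q - 1" and Q: "Q - 1 \<noteq> 0"
    using two_le_card by (simp_all add: Q_def of_nat_diff)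
  have "plane_class h (CARD('a) + 1) = (osculating_planes h :: ('a ^ 4) set set)"
    by (simp add: plane_class_def point_class_def osculating_planes_def)
  then show "r (CARD('a) + 1) = i"
    using card_osculating_planes[of p] z by (simp add: r_def p(2))
  have w: "(Q - 1) * r d = real (weight_count {y. alt_form p y = 0} d)" if "d \<noteq> 1" "d \<noteq> CARD('a) + 1" for d
    unfolding card_plane_class_weight[OF that, symmetric] r_def p(2) of_nat_mult Q1 ..
  note wp = weight_count_plane[OF p(1) p', folded Q_def, unfolded z]
  have "(Q - 1) * r 0 = (Q - 1) * ((Q\<^sup>2 + xi * Q + 1 - i) / 3)"
    unfolding wp(1)[symmetric] using big by (intro w) simp_all
  then show "r 0 = (Q\<^sup>2 + xi * Q + 1 - i) / 3"
    using Q by (simp only: mult_cancel_left simp_thms)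
  have "(Q - 1) * r 2 = (Q - 1) * (Q + 1 - i)"
    unfolding wp(3)[symmetric] using big by (intro w) simp_all
  then show "r 2 = Q + 1 - i"
    using Q by (simp only: mult_cancel_left simp_thms)
  have "(Q - 1) * r 3 = (Q - 1) * ((Q\<^sup>2 + xi * Q - 2 + 2 * real i) / 6)"
    unfolding wp(4)[symmetric] using big by (intro w) simp_all
  then show "r 3 = (Q\<^sup>2 + xi * Q - 2 + 2 * real i) / 6"
    using Q by (simp only: mult_cancel_left simp_thms)
  have "(Q - 1) * (r 1 + i) = real (weight_count {y. alt_form p y = 0} 1)"
    unfolding card_plane_class_weight_1[symmetric] r_def p(2) of_nat_mult Q1 of_nat_add z ..
  then have "r 1 + i = Q * (Q - xi) / 2 + i"
    unfolding wp(2) using Q by simp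
  then show "r 1 = Q * (Q - xi) / 2" by simp
qed

end

theorem proposition3p9:
  fixes n h q :: nat and \<xi> :: int
  assumes "n \<ge> 3" and "q = 2 ^ n" and "CARD('a::{field,finite}) = q"
    and "h > 0" and "gcd n h = 1"
    and "\<xi> \<in> {1, -1}" and "[int q = \<xi>] (mod 3)"
  shows "(\<forall>P \<in> (point_class h 0 :: ('a ^ 4) set set).
            let r = (\<lambda>d. real (card {\<pi> \<in> plane_class h d. P \<subseteq> \<pi>}))
            in r (q + 1) = 0
             \<and> r 0 = (real q ^ 2 + of_int \<xi> * real q + 1) / 3
             \<and> r 1 = real q * (real q - of_int \<xi>) / 2
             \<and> r 2 = real q + 1
             \<and> r 3 = (real q ^ 2 + of_int \<xi> * real q - 2) / 6)
       \<and> (\<forall>P \<in> (point_class h 3 :: ('a ^ 4) set set).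
            let r = (\<lambda>d. real (card {\<pi> \<in> plane_class h d. P \<subseteq> \<pi>}))
            in r (q + 1) = 3
             \<and> r 0 = (real q ^ 2 + of_int \<xi> * real q - 2) / 3
             \<and> r 1 = real q * (real q - of_int \<xi>) / 2
             \<and> r 2 = real q - 2
             \<and> r 3 = (real q ^ 2 + of_int \<xi> * real q + 4) / 6)"
proof -
  interpret even_field n h "TYPE('a)"
    using assms by unfold_locales simp_all
  \<comment> \<open>Keeps the indices 0 to 3 apart from \<open>q + 1\<close>, which
    \<open>point_class\<close> treats separately.\<close>
  have "(2::nat) ^ 3 \<le> 2 ^ n" using assms(1) by (intro power_increasing) simp_all
  then have q: "3 < q + 1" "0 \<noteq> q + 1" "3 \<noteq> q + 1" using assms(2) by simp_all
  have mod_four: "(4::int) ^ m mod 3 = 1" for m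
    by (induction m) (auto simp: mod_mult_right_eq[symmetric])
  \<comment> \<open>Modulo 3, \<open>2 ^ n\<close> is 1 or -1 according to the parity of
    \<open>n\<close>.\<close>
  have "of_int \<xi> = xi"
  proof (cases "even n")
    case True
    then obtain m where "n = 2 * m" by blast
    then have "int q mod 3 = 1" using mod_four[of m] assms(2) by (simp add: power_mult)
    then have "\<xi> = 1" using assms(6,7) by (auto simp: cong_def)
    then show ?thesis using True by (simp add: xi_def)
  next
    case False
    then obtain m where m: "n = 2 * m + 1" by (auto elim: oddE)
    define x where "x = (4::int) ^ m"
    have "x mod 3 = 1" "int q = 2 * x" using mod_four[of m] assms(2) m by (simp_all add: x_def power_mult)
    then have "int q mod 3 = 2" by presburger
    then have "\<xi> = -1" using assms(6,7) by (auto simp: cong_def)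
    then show ?thesis using False by (simp add: xi_def)
  qed
  note counts = plane_class_counts[unfolded assms(3), OF _ _ q(1), folded this]
  show ?thesis
    unfolding Let_def
    using counts[of 0] counts[of 3] q(2,3) by simp
qed

end
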